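(* Let $k\geq 1$ be an integer. (1) If $x,y$ are two complex numbers such that $\mathrm{Re}(x)>|\mathrm{Im}(y)|$, then $$\frac{(\pi y)^{\frac{k}{4}-\frac{1}{2}}}{2^{\frac{k}{4}-\frac{1}{2}}\Gamma\left(\frac{k}{4}+\frac{1}{2}\right)}+\sum_{n=1}^{\infty}\frac{r_{k}(n)}{n^{\frac{k}{4}-\frac{1}{2}}}\,e^{-\pi nx}J_{\frac{k}{4}-\frac{1}{2}}\left(\pi ny\right)=\frac{(\pi y)^{\frac{k}{4}-\frac{1}{2}}}{2^{\frac{k}{4}-\frac{1}{2}}\Gamma\left(\frac{k}{4}+\frac{1}{2}\right)\left(x^{2}+y^{2}\right)^{\frac{k}{4}}}+\frac{1}{\sqrt{x^{2}+y^{2}}}\sum_{n=1}^{\infty}\frac{r_{k}(n)}{n^{\frac{k}{4}-\frac{1}{2}}}\,e^{-\frac{\pi nx}{x^{2}+y^{2}}}J_{\frac{k}{4}-\frac{1}{2}}\left(\frac{\pi ny}{x^{2}+y^{2}}\right).$$ (2) If $x,y$ are two complex numbers such that $\mathrm{Re}(x)>|\mathrm{Re}(y)|$, then $$\frac{(\pi y)^{\frac{k}{4}-\frac{1}{2}}}{2^{\frac{k}{4}-\frac{1}{2}}\Gamma\left(\frac{k}{4}+\frac{1}{2}\right)}+\sum_{n=1}^{\infty}\frac{r_{k}(n)}{n^{\frac{k}{4}-\frac{1}{2}}}\,e^{-\pi nx}I_{\frac{k}{4}-\frac{1}{2}}\left(\pi ny\right)=\frac{(\pi y)^{\frac{k}{4}-\frac{1}{2}}}{2^{\frac{k}{4}-\frac{1}{2}}\Gamma\left(\frac{k}{4}+\frac{1}{2}\right)\left(x^{2}-y^{2}\right)^{\frac{k}{4}}}+\frac{1}{\sqrt{x^{2}-y^{2}}}\sum_{n=1}^{\infty}\frac{r_{k}(n)}{n^{\frac{k}{4}-\frac{1}{2}}}\,e^{-\frac{\pi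 nx}{x^{2}-y^{2}}}I_{\frac{k}{4}-\frac{1}{2}}\left(\frac{\pi ny}{x^{2}-y^{2}}\right).$$
   Context: For a positive integer $k$, $r_k(n)$ denotes the number of representations of the positive integer $n$ as a sum of $k$ squares, i.e. the number of $(m_1,\dots,m_k)\in\mathbb{Z}^k$ with $m_1^2+\cdots+m_k^2=n$ (so order and signs count). $J_\nu$ and $I_\nu$ are the Bessel and modified Bessel functions of the first kind: $$J_\nu(z)=\left(\tfrac z2\right)^{\nu}\sum_{j=0}^\infty\frac{(-1)^j (z/2)^{2j}}{j!\,\Gamma(\nu+j+1)},\qquad I_\nu(z)=\left(\tfrac z2\right)^{\nu}\sum_{j=0}^\infty\frac{(z/2)^{2j}}{j!\,\Gamma(\nu+j+1)}.$$ Branches: $y^{\alpha}$ and $(x^2\pm y^2)^{\alpha}$ (including square roots) are principal powers; under the respective hypotheses $x^2+y^2$ (in (1)) and $x^2-y^2$ (in (2)) do not lie on $(-\infty,0]$. For $c>0$, the power $\left(\frac{cy}{x^2\pm y^2}\right)^{\alpha}$ occurring in the definition of the Bessel functions is understood as $c^{\alpha}y^{\alpha}(x^2\pm y^2)^{-\alpha}$; similarly $(cy)^{\alpha}=c^{\alpha}y^{\alpha}$. For $k=1$ (negative exponent $\frac k4-\frac12$) it is understood that $y\neq 0$; for $k=2$, $y^0=1$ also at $y=0$. *)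

theory Defs
  imports "HOL-Analysis.Analysis"
begin

definition rep_squares :: "nat \<Rightarrow> nat \<Rightarrow> nat" where
  "rep_squares k n = card {m :: int list. length m = k \<and> (\<Sum>a\<leftarrow>m. a ^ 2) = int n}"

(* Principal power, with z^0 = 1 also at z = 0 (whereas 0 powr 0 = 0). *)
definition ppow :: "complex \<Rightarrow> complex \<Rightarrow> complex" where
  "ppow z a = (if a = 0 then 1 else z powr a)"

(* The series factors of J and I.  At the poles of the Gamma function, Gamma is 0 here and
   division by 0 gives 0, so 1 / Gamma has its usual value 0 there. *)
definition bessel_J_series :: "complex \<Rightarrow> complex \<Rightarrow> complex" where
  "bessel_J_series \<nu> z =
     (\<Sum>j. (-1) ^ j * (z / 2) ^ (2 * j) / (fact j * Gamma (\<nu> + of_nat j + 1)))"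

definition bessel_I_series :: "complex \<Rightarrow> complex \<Rightarrow> complex" where
  "bessel_I_series \<nu> z =
     (\<Sum>j. (z / 2) ^ (2 * j) / (fact j * Gamma (\<nu> + of_nat j + 1)))"

definition bessel_J :: "complex \<Rightarrow> complex \<Rightarrow> complex" where
  "bessel_J \<nu> z = ppow (z / 2) \<nu> * bessel_J_series \<nu> z"

definition bessel_I :: "complex \<Rightarrow> complex \<Rightarrow> complex" where
  "bessel_I \<nu> z = ppow (z / 2) \<nu> * bessel_I_series \<nu> z"

(* J and I of order \<nu> at the point c * y / w with c > 0, where the power
   (c * y / (2 * w))^\<nu> is read as (c / 2)^\<nu> * y^\<nu> * w^(-\<nu>) with principal powers.  This need
   not be the principal power of the quotient, so it differs in general from
   bessel_J \<nu> (c * y / w) and bessel_I \<nu> (c * y / w). *)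
definition bessel_J_quot :: "complex \<Rightarrow> real \<Rightarrow> complex \<Rightarrow> complex \<Rightarrow> complex" where
  "bessel_J_quot \<nu> c y w =
     ppow (of_real (c / 2)) \<nu> * ppow y \<nu> * ppow w (- \<nu>) * bessel_J_series \<nu> (of_real c * y / w)"

definition bessel_I_quot :: "complex \<Rightarrow> real \<Rightarrow> complex \<Rightarrow> complex \<Rightarrow> complex" where
  "bessel_I_quot \<nu> c y w =
     ppow (of_real (c / 2)) \<nu> * ppow y \<nu> * ppow w (- \<nu>) * bessel_I_series \<nu> (of_real c * y / w)"

end

theory Submission
  imports Defs "HOL-Complex_Analysis.Complex_Analysis" "HOL-Real_Asymp.Real_Asymp"
begin

text \<open>
  Put \<mu> = k/4, so that \<nu> = \<mu> - 1/2.  In both parts the powers of n and y cancel or factor out: with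
  S the series factor of I and z = y (for I) or z = i y (for J), both claims say that
  F(x, z), the sum over n \<ge> 0 of r_k(n) exp(- \<pi> n x) S(\<pi> n z), satisfies
  F(x, z) = w^(- \<mu>) F(x/w, z/w) with w = x^2 - z^2.  The term n = 0 is the summand outside the series.

  For real x > |z| this comes from the modularity of the theta function.  By Poisson's integral
  (lemma \<open>bessel_I_series_integral\<close>), S(t) is a multiple of the integral of exp(t u) (1 - u^2)^(\<mu> - 1)
  over [-1, 1], and therefore F(x, z) is the same multiple of the integral of
  \<theta>(x - z u)^k (1 - u^2)^(\<mu> - 1), where \<theta>(s) is the sum of exp(- \<pi> m^2 s) over all integers m.
  The Moebius map v = (x u - z) / (x - z u) preserves [-1, 1], turns (x + z v) / w into 1 / (x - z u), and
  multiplies the weight by exactly the power of x - z u that \<theta>(1/s) = s^(1/2) \<theta>(s) produces; this is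
  lemma \<open>theta_power_integral_moebius\<close>.  Complex x and z are reached by analytic continuation along a
  complex line through the pair of real parts (\<open>theta_bessel_transformation\<close>).

  The inversion of \<theta> is proved by a discrete Poisson summation: evaluating the sum of cos(\<pi> k/m)^(2n)
  over k modulo m with the binomial theorem gives an identity between two finite sums
  (\<open>sum_even_powers_cos\<close>), and as n and m tend to infinity with m^2/n tending to s the two sides become
  Gaussian sums at s and at \<pi>^2/s.  The normalising constant is found by comparing with s = \<pi>, where
  both Gaussian sums coincide.
\<close>

section \<open>A finite theta inversion\<close>

lemma cos_power_even_expansion:
  fixes x :: real
  shows "(2 * cos x) ^ (2 * n) = real ((2 * n) choose n)
    + 2 * (\<Sum>d=1..n. real ((2 * n) choose (n + d)) * cos (2 * real d * x))"
proof -
  define g where "g l = real ((2 * n) choose l) * cos ((2 * real l - 2 * real n) * x)" for l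
  have "cis x + cis (- x) = of_real (2 * cos x)"
    by (simp add: complex_eq_iff)
  then have "complex_of_real ((2 * cos x) ^ (2 * n)) = (cis x + cis (- x)) ^ (2 * n)"
    by (simp only: of_real_power)
  also have "\<dots> = (\<Sum>l\<le>2 * n. of_nat ((2 * n) choose l) * cis x ^ l * cis (- x) ^ (2 * n - l))"
    by (rule binomial_ring)
  also have "\<dots> = (\<Sum>l\<le>2 * n. of_nat ((2 * n) choose l) * cis ((2 * real l - 2 * real n) * x))"
    by (intro sum.cong) (auto simp: Complex.DeMoivre cis_mult of_nat_diff algebra_simps)
  finally have "(2 * cos x) ^ (2 * n) = Re (\<Sum>l\<le>2 * n. of_nat ((2 * n) choose l) * cis ((2 * real l - 2 * real n) * x))"
    by (metis Re_complex_of_real)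
  also have "\<dots> = (\<Sum>l\<le>2 * n. g l)"
    by (simp add: g_def)
  also have "{..2 * n} = {..<n} \<union> ({n} \<union> {n + 1..2 * n})" by auto
  also have "sum g \<dots> = sum g {..<n} + (sum g {n} + sum g {n + 1..2 * n})"
  proof -
    have "sum g ({..<n} \<union> ({n} \<union> {n + 1..2 * n})) = sum g {..<n} + sum g ({n} \<union> {n + 1..2 * n})"
      by (rule sum.union_disjoint) auto
    also have "sum g ({n} \<union> {n + 1..2 * n}) = sum g {n} + sum g {n + 1..2 * n}"
      by (rule sum.union_disjoint) auto
    finally show ?thesis .
  qed
  also have "sum g {n + 1..2 * n} = (\<Sum>d=1..n. g (n + d))"
    by (rule sum.reindex_bij_witness[of _ "\<lambda>d. n + d" "\<lambda>l. l - n"]) auto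
  also have "sum g {..<n} = (\<Sum>d=1..n. g (n + d))"
  proof (rule sum.reindex_bij_witness[of _ "\<lambda>d. n - d" "\<lambda>l. n - l"], goal_cases)
    case (5 l)
    then have l: "l \<le> n" by auto
    have "(2 * n) choose (2 * n - l) = (2 * n) choose l"
      by (rule binomial_symmetric[symmetric]) (use l in auto)
    moreover have "n + (n - l) = 2 * n - l" using l by simp
    moreover have "cos ((2 * real (2 * n - l) - 2 * real n) * x) = cos ((2 * real l - 2 * real n) * x)"
      using l by (subst cos_minus[symmetric]) (simp add: of_nat_diff algebra_simps)
    ultimately show ?case by (simp add: g_def)
  qed auto
  finally show ?thesis
    by (simp add: g_def sum_distrib_left algebra_simps)
qed

lemma sum_cos_roots_of_unity:
  assumes "m > 0"
  shows "(\<Sum>k<m. cos (2 * pi * real d * real k / real m)) = (if m dvd d then real m else 0)"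
proof -
  define z where "z = cis (2 * pi * real d / real m)"
  have pow: "z ^ k = cis (2 * pi * real d * real k / real m)" for k
    unfolding z_def Complex.DeMoivre by (simp add: mult_ac)
  have z1: "z = 1 \<longleftrightarrow> m dvd d"
    using complex_root_unity_eq_1[of m d] assms by (simp add: z_def cis_conv_exp mult_ac)
  have "(\<Sum>k<m. cos (2 * pi * real d * real k / real m)) = Re (\<Sum>k<m. z ^ k)"
    by (simp add: pow)
  also have "(\<Sum>k<m. z ^ k) = (if m dvd d then of_nat m else 0)"
  proof (cases "m dvd d")
    case False
    have "z ^ m = cis (2 * pi * real d)" using assms by (simp add: pow)
    also have "\<dots> = 1" by (rule cis_multiple_2pi) simp
    finally show ?thesis using False z1 by (simp add: geometric_sum)
  next
    case True
    then have "z = 1" using z1 by blast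
    then show ?thesis using True by simp
  qed
  finally show ?thesis by simp
qed

text \<open>
  Summing the expansion of cos(\<pi> k/m)^(2n) over k modulo m keeps exactly the frequencies divisible by m,
  which is Poisson summation on the integers modulo m.  For odd m the nonzero residues pair up as k and
  m - k, with the same even power of the cosine, and every angle that remains lies in [0, \<pi>/2).
\<close>

lemma sum_even_powers_cos:
  assumes m: "m = 2 * p + 1"
  shows "real ((2 * n) choose n) + 2 * (\<Sum>j. real ((2 * n) choose (n + Suc j * m)))
     = 4 ^ n / real m * (1 + 2 * (\<Sum>k. if k < p then cos (pi * real (Suc k) / real m) ^ (2 * n) else 0))"
proof -
  have m0: "m > 0" using m by simp
  let ?c = "\<lambda>k. cos (pi * real k / real m) ^ (2 * n)"
  let ?b = "\<lambda>d. real ((2 * n) choose (n + d))"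
  have "4 ^ n * (\<Sum>k<m. ?c k) = (\<Sum>k<m. (2 * cos (pi * real k / real m)) ^ (2 * n))"
    by (simp add: sum_distrib_left power_mult_distrib power_mult)
  also have "\<dots> = (\<Sum>k<m. ?b 0 + 2 * (\<Sum>d=1..n. ?b d * cos (2 * pi * real d * real k / real m)))"
    unfolding cos_power_even_expansion by (simp add: mult_ac)
  also have "\<dots> = real m * ?b 0 + 2 * (\<Sum>d=1..n. ?b d * (\<Sum>k<m. cos (2 * pi * real d * real k / real m)))"
    by (simp add: sum.distrib sum_distrib_left mult_ac sum.swap[of _ "{..<m}"])
  also have "(\<Sum>d=1..n. ?b d * (\<Sum>k<m. cos (2 * pi * real d * real k / real m)))
      = (\<Sum>d\<in>{d\<in>{1..n}. m dvd d}. real m * ?b d)"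
    unfolding sum_cos_roots_of_unity[OF m0]
    by (subst sum.inter_filter) (auto intro!: sum.cong)
  also have "\<dots> = (\<Sum>j\<in>{j\<in>{..<n}. Suc j * m \<le> n}. real m * ?b (Suc j * m))"
  proof (rule sum.reindex_cong[of "\<lambda>j. Suc j * m"])
    show "inj_on (\<lambda>j. Suc j * m) {j \<in> {..<n}. Suc j * m \<le> n}"
      using m0 by (intro inj_onI) (simp del: mult_Suc)
    show "{d \<in> {1..n}. m dvd d} = (\<lambda>j. Suc j * m) ` {j \<in> {..<n}. Suc j * m \<le> n}"
    proof (intro equalityI subsetI)
      fix d assume "d \<in> {d \<in> {1..n}. m dvd d}"
      then obtain q where d: "d = m * q" "d > 0" "d \<le> n" by (auto elim!: dvdE)
      then obtain j where q: "q = Suc j" by (cases q) auto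
      have dj: "d = Suc j * m" using d q by (simp only: mult.commute)
      have "Suc j \<le> Suc j * m" using m0 by (cases m) auto
      then have "j < n" using d dj by linarith
      with d dj show "d \<in> (\<lambda>j. Suc j * m) ` {j \<in> {..<n}. Suc j * m \<le> n}"
        by (intro image_eqI[of _ _ j]) (simp_all del: mult_Suc)
    next
      fix d assume "d \<in> (\<lambda>j. Suc j * m) ` {j \<in> {..<n}. Suc j * m \<le> n}"
      then obtain j where d: "d = Suc j * m" "d \<le> n" by blast
      have "m dvd d" unfolding d(1) by (rule dvd_triv_right)
      then show "d \<in> {d \<in> {1..n}. m dvd d}" using m0 d by (cases "d = 0") simp_all
    qed
  qed (rule refl)
  also have "\<dots> = (\<Sum>j<n. real m * ?b (Suc j * m))"
  proof (rule sum.mono_neutral_left)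
    show "finite {..<n}" by simp
    show "\<forall>j\<in>{..<n} - {j \<in> {..<n}. Suc j * m \<le> n}. real m * ?b (Suc j * m) = 0"
    proof
      fix j assume "j \<in> {..<n} - {j \<in> {..<n}. Suc j * m \<le> n}"
      then have "\<not> Suc j * m \<le> n" by blast
      then have "2 * n < n + Suc j * m" by linarith
      then show "real m * ?b (Suc j * m) = 0" by (simp only: binomial_eq_0)
    qed
  qed blast+
  also have "\<dots> = real m * (\<Sum>j<n. ?b (Suc j * m))"
    by (rule sum_distrib_left[symmetric])
  also have "(\<Sum>j<n. ?b (Suc j * m)) = (\<Sum>j. ?b (Suc j * m))"
  proof (rule suminf_finite[symmetric], goal_cases)
    case (2 j)
    have "Suc j \<le> Suc j * m" using m0 by (cases m) auto
    moreover have "n \<le> j" using 2 by simp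
    ultimately have "2 * n < n + Suc j * m" by linarith
    then show ?case by (simp only: binomial_eq_0)
  qed auto
  finally have A: "4 ^ n * (\<Sum>k<m. ?c k) = real m * (?b 0 + 2 * (\<Sum>j. ?b (Suc j * m)))"
    by (simp add: algebra_simps)
  have "(\<Sum>k<m. ?c k) = sum ?c ({0} \<union> ({1..p} \<union> {p + 1..2 * p}))"
    using m by (intro sum.cong) auto
  also have "\<dots> = sum ?c {0} + sum ?c ({1..p} \<union> {p + 1..2 * p})"
    by (rule sum.union_disjoint) auto
  also have "sum ?c ({1..p} \<union> {p + 1..2 * p}) = sum ?c {1..p} + sum ?c {p + 1..2 * p}"
    by (rule sum.union_disjoint) auto
  also have "sum ?c {p + 1..2 * p} = sum ?c {1..p}"
  proof (rule sum.reindex_cong[of "\<lambda>k. m - k"])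
    show "inj_on (\<lambda>k. m - k) {1..p}" unfolding m by (intro inj_onI) auto
    have "k \<in> (\<lambda>k. m - k) ` {1..p}" if "k \<in> {p + 1..2 * p}" for k
      using that unfolding m by (intro image_eqI[of _ _ "2 * p + 1 - k"]) auto
    moreover have "m - k \<in> {p + 1..2 * p}" if "k \<in> {1..p}" for k
      using that unfolding m by auto
    ultimately show "{p + 1..2 * p} = (\<lambda>k. m - k) ` {1..p}" by blast
    fix k assume "k \<in> {1..p}"
    then have "k \<le> m" using m by auto
    then have "pi * real (m - k) / real m = pi - pi * real k / real m"
      using m0 by (simp add: of_nat_diff diff_divide_distrib right_diff_distrib)
    then have "cos (pi * real (m - k) / real m) = - cos (pi * real k / real m)" by simp
    then show "?c (m - k) = ?c k" by simp
  qed
  also have "sum ?c {1..p} = (\<Sum>k<p. ?c (Suc k))"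
    by (rule sum.reindex_bij_witness[of _ Suc "\<lambda>k. k - 1"]) auto
  also have "\<dots> = (\<Sum>k. if k < p then ?c (Suc k) else 0)"
    by (subst suminf_finite[of "{..<p}"]) auto
  finally have "(\<Sum>k<m. ?c k) = 1 + 2 * (\<Sum>k. if k < p then ?c (Suc k) else 0)"
    by simp
  then have "4 ^ n * (1 + 2 * (\<Sum>k. if k < p then ?c (Suc k) else 0))
      = real m * (?b 0 + 2 * (\<Sum>j. ?b (Suc j * m)))"
    using A by (simp only:)
  moreover have "r * x = real m * a \<Longrightarrow> a = r / real m * x" for r x a
    using m0 by (simp add: field_simps)
  ultimately show ?thesis by (simp only: add_0_right)
qed

text \<open>
  A reverse of 1 - y \<le> exp(-y) that is still sharp to first order at 0; the lower Gaussian bounds below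
  need it.
\<close>

lemma exp_neg_quot_le:
  fixes y :: real
  assumes "0 \<le> y" "y < 1"
  shows "exp (- (y / (1 - y))) \<le> 1 - y"
proof -
  have "1 / (1 - y) = 1 + y / (1 - y)" using assms by (simp add: field_simps)
  also have "\<dots> \<le> exp (y / (1 - y))" by (rule exp_ge_add_one_self)
  finally show ?thesis using assms by (simp add: exp_minus field_simps)
qed

text \<open>
  Comparing each factor with an exponential traps the quotient between two Gaussians whose exponents
  agree asymptotically when l is of the order of the square root of n.
\<close>

lemma central_binomial_ratio:
  assumes "l \<le> n"
  shows "real ((2 * n) choose (n + l)) / real ((2 * n) choose n) = (\<Prod>i=1..l. 1 - real l / real (n + i))"
proof -
  have "real ((2 * n) choose (n + l)) / real ((2 * n) choose n) = fact n * fact n / (fact (n + l) * fact (n - l))"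
    using assms by (simp add: binomial_fact mult_2)
  also have "fact (n + l) = (fact n :: real) * (\<Prod>i=1..l. real (n + i))"
    by (induction l) (simp_all add: algebra_simps)
  also have "fact n = (fact (n - l) :: real) * (\<Prod>i=1..l. real (n - l + i))"
  proof -
    have "fact (q + l) = (fact q :: real) * (\<Prod>i=1..l. real (q + i))" for q
      by (induction l) (simp_all add: algebra_simps)
    from this[of "n - l"] show ?thesis using assms by simp
  qed
  also have "fact (n - l) * (\<Prod>i=1..l. real (n - l + i)) * (fact (n - l) * (\<Prod>i=1..l. real (n - l + i)))
       / (fact (n - l) * (\<Prod>i=1..l. real (n - l + i)) * (\<Prod>i=1..l. real (n + i)) * fact (n - l))
     = (\<Prod>i=1..l. real (n - l + i)) / (\<Prod>i=1..l. real (n + i))"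
    by simp
  also have "\<dots> = (\<Prod>i=1..l. 1 - real l / real (n + i))"
    unfolding prod_dividef[symmetric] using assms
    by (intro prod.cong) (auto simp: of_nat_diff field_simps)
  finally show ?thesis .
qed

lemma central_binomial_ratio_upper:
  assumes "n > 0"
  shows "real ((2 * n) choose (n + l)) / real ((2 * n) choose n) \<le> exp (- (real l ^ 2 / (real n + real l)))"
proof (cases "l \<le> n")
  case True
  have "(\<Prod>i=1..l. 1 - real l / real (n + i)) \<le> (\<Prod>i=1..l. exp (- (real l / (real n + real l))))"
  proof (rule prod_mono, safe)
    fix i assume i: "i \<in> {1..l}"
    show "0 \<le> 1 - real l / real (n + i)" using True i by (simp add: field_simps)
    have "real l / (real n + real l) \<le> real l / real (n + i)"
      using True i assms by (intro divide_left_mono) auto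
    then have "1 - real l / real (n + i) \<le> 1 + - (real l / (real n + real l))" by simp
    also have "\<dots> \<le> exp (- (real l / (real n + real l)))" by (rule exp_ge_add_one_self)
    finally show "1 - real l / real (n + i) \<le> exp (- (real l / (real n + real l)))" .
  qed
  then show ?thesis using True
    by (simp add: central_binomial_ratio power2_eq_square flip: exp_of_nat_mult)
qed (simp add: binomial_eq_0)

text \<open>
  Here the exponent is quadratic in l for fixed n, without l in the denominator; this makes a summable majorant.
\<close>

lemma central_binomial_ratio_upper':
  assumes "n > 0"
  shows "real ((2 * n) choose (n + l)) / real ((2 * n) choose n) \<le> exp (- (real l ^ 2 / (2 * real n)))"
proof (cases "l \<le> n")
  case True
  have "real l ^ 2 / (2 * real n) \<le> real l ^ 2 / (real n + real l)"
    using assms True by (intro divide_left_mono) auto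
  with central_binomial_ratio_upper[OF assms, of l] show ?thesis
    by (meson exp_le_cancel_iff le_imp_neg_le order_trans)
qed (simp add: binomial_eq_0)

lemma central_binomial_ratio_lower:
  assumes "l < n"
  shows "exp (- (real l ^ 2 / (real n - real l))) \<le> real ((2 * n) choose (n + l)) / real ((2 * n) choose n)"
proof -
  have "(\<Prod>i=1..l. exp (- (real l / (real n - real l)))) \<le> (\<Prod>i=1..l. 1 - real l / real (n + i))"
  proof (rule prod_mono, safe)
    fix i assume i: "i \<in> {1..l}"
    have "exp (- (real l / (real n - real l))) \<le> exp (- (real l / real (n + i) / (1 - real l / real (n + i))))"
    proof -
      have "real l / real (n + i) / (1 - real l / real (n + i)) = real l / (real n + real i - real l)"
      proof -
        have "1 - real l / real (n + i) = (real n + real i - real l) / real (n + i)"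
          using assms by (simp add: field_simps)
        then show ?thesis using assms by simp
      qed
      also have "\<dots> \<le> real l / (real n - real l)"
        using assms by (intro divide_left_mono) auto
      finally show ?thesis by simp
    qed
    also have "\<dots> \<le> 1 - real l / real (n + i)"
      using assms by (intro exp_neg_quot_le) (auto simp: field_simps)
    finally show "exp (- (real l / (real n - real l))) \<le> 1 - real l / real (n + i)" .
  qed auto
  then show ?thesis using assms
    by (simp add: central_binomial_ratio power2_eq_square flip: exp_of_nat_mult)
qed

text \<open>
  The function cos(t) exp(t^2/2) decreases on [0, \<pi>/2), because its derivative has the sign of
  t cos(t) - sin(t) and t \<le> tan(t).
\<close>

lemma cos_le_exp:
  fixes x :: real
  assumes "0 \<le> x" "x \<le> pi / 2"
  shows "cos x \<le> exp (- (x ^ 2 / 2))"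
proof (cases "x = pi / 2")
  case False
  with assms have x: "0 \<le> x" "x < pi / 2" by auto
  define f where "f = (\<lambda>t. cos t * exp (t ^ 2 / 2) :: real)"
  have "f x \<le> f 0"
  proof (rule DERIV_nonpos_imp_nonincreasing[OF x(1)])
    fix t assume t: "0 \<le> t" "t \<le> x"
    have c: "cos t > 0" using t x by (intro cos_gt_zero_pi) auto
    have "t \<le> tan t" if "t > 0"
    proof -
      have "(\<lambda>u. tan u - u) 0 \<le> (\<lambda>u. tan u - u) t"
      proof (rule DERIV_nonneg_imp_nondecreasing[OF t(1)])
        fix u assume u: "0 \<le> u" "u \<le> t"
        have "cos u > 0" using u t x by (intro cos_gt_zero_pi) auto
        moreover have "cos u ^ 2 \<le> 1" by (simp add: abs_square_le_1)
        ultimately show "\<exists>y. ((\<lambda>u. tan u - u) has_real_derivative y) (at u) \<and> 0 \<le> y"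
          by (intro exI[of _ "inverse (cos u ^ 2) - 1"]) (auto intro!: derivative_eq_intros simp: one_le_inverse)
      qed
      then show ?thesis by simp
    qed
    then have "t * cos t \<le> sin t" using c t by (cases "t = 0") (auto simp: tan_def field_simps)
    then have "exp (t ^ 2 / 2) * (t * cos t - sin t) \<le> 0"
      by (intro mult_nonneg_nonpos) auto
    moreover have "(f has_real_derivative exp (t ^ 2 / 2) * (t * cos t - sin t)) (at t)"
      unfolding f_def by (auto intro!: derivative_eq_intros simp: algebra_simps)
    ultimately show "\<exists>y. (f has_real_derivative y) (at t) \<and> y \<le> 0" by blast
  qed
  then show ?thesis by (simp add: f_def exp_minus field_simps)
next
  case True
  then show ?thesis by (simp only: cos_pi_half) simp
qed

lemma cos_ge_parabola: "1 - x ^ 2 / 2 \<le> cos (x :: real)"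
proof -
  have "sin (x / 2) ^ 2 \<le> (x / 2) ^ 2"
    using abs_sin_x_le_abs_x[of "x / 2"] by (simp only: abs_le_square_iff)
  then show ?thesis using cos_double_sin[of "x / 2"] by (simp add: power_divide)
qed

lemma cos_power_upper:
  assumes "0 \<le> x" "x \<le> pi / 2"
  shows "cos x ^ (2 * n) \<le> exp (- (real n * x ^ 2))"
proof -
  have "cos x ^ (2 * n) \<le> exp (- (x ^ 2 / 2)) ^ (2 * n)"
    using assms by (intro power_mono cos_le_exp cos_ge_zero) auto
  then show ?thesis by (simp flip: exp_of_nat_mult)
qed

lemma cos_power_lower:
  assumes "0 \<le> x" "x < 1"
  shows "exp (- (real n * x ^ 2 / (1 - x ^ 2 / 2))) \<le> cos x ^ (2 * n)"
proof -
  have x2: "x ^ 2 < 1" using assms by (simp add: power_less_one_iff)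
  have "exp (- (x ^ 2 / 2 / (1 - x ^ 2 / 2))) \<le> 1 - x ^ 2 / 2"
    using x2 by (intro exp_neg_quot_le) auto
  also have "\<dots> \<le> cos x" by (rule cos_ge_parabola)
  finally have "exp (- (x ^ 2 / 2 / (1 - x ^ 2 / 2))) ^ (2 * n) \<le> cos x ^ (2 * n)"
    by (intro power_mono) auto
  moreover have "real (2 * n) * (x ^ 2 / 2 / (1 - x ^ 2 / 2)) = real n * x ^ 2 / (1 - x ^ 2 / 2)"
    using x2 by (simp add: field_simps)
  ultimately show ?thesis
    by (metis exp_of_nat_mult mult_minus_right)
qed

section \<open>Jacobi's inversion of the theta series\<close>

text \<open>
  The sum of exp(- a^2 s) over all integers a, folded to nonnegative indices, where Tannery's theorem
  applies directly; in terms of \<theta> from above it is \<theta>(s/\<pi>).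
\<close>

definition gauss_sum :: "real \<Rightarrow> real" where
  "gauss_sum s = 1 + 2 * (\<Sum>j. exp (- (real (Suc j) ^ 2 * s)))"

lemma summable_gauss_sum:
  assumes "s > 0"
  shows "summable (\<lambda>j. exp (- (real (Suc j) ^ 2 * s)))"
proof (rule summable_comparison_test')
  show "summable (\<lambda>j. exp (- s) ^ j)" using assms by (intro summable_geometric) auto
  fix j
  have "real j * s \<le> real (Suc j) ^ 2 * s"
    using assms by (intro mult_right_mono) (auto simp: power2_eq_square algebra_simps)
  then show "norm (exp (- (real (Suc j) ^ 2 * s))) \<le> exp (- s) ^ j"
    by (simp flip: exp_of_nat_mult)
qed

lemma gauss_sum_ge_1: "s > 0 \<Longrightarrow> gauss_sum s \<ge> 1"
  unfolding gauss_sum_def using suminf_nonneg[OF summable_gauss_sum] by fastforce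

lemma tendsto_gauss_sum:
  fixes a :: "nat \<Rightarrow> nat \<Rightarrow> real"
  assumes "\<And>j. (\<lambda>n. a j n) \<longlonglongrightarrow> exp (- (real (Suc j) ^ 2 * s))"
    and "\<forall>\<^sub>F n in sequentially. \<forall>j. \<bar>a j n\<bar> \<le> exp (- (real (Suc j) ^ 2 * t))" and "t > 0"
  shows "(\<lambda>n. 1 + 2 * (\<Sum>j. a j n)) \<longlonglongrightarrow> gauss_sum s"
proof -
  have "\<forall>\<^sub>F (j, n) in at_top \<times>\<^sub>F sequentially. norm (a j n) \<le> exp (- (real (Suc j) ^ 2 * t))"
  proof -
    have "\<forall>\<^sub>F x in at_top \<times>\<^sub>F sequentially. True \<and> (\<forall>j. \<bar>a j (snd x)\<bar> \<le> exp (- (real (Suc j) ^ 2 * t)))"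
      by (rule eventually_prodI[OF always_eventually assms(2)]) simp
    then show ?thesis by (rule eventually_mono) auto
  qed
  from tannerys_theorem[OF assms(1) this summable_gauss_sum[OF assms(3)]]
  show ?thesis unfolding gauss_sum_def by (intro tendsto_intros) auto
qed

text \<open>
  The scaling regime: the modulus m grows like the square root of s n, so that the binomial coefficients
  at distance j m from the centre and the cosines at the angles \<pi> j/m both have Gaussian limits.
\<close>

context
  fixes m :: "nat \<Rightarrow> nat" and s :: real
  assumes s: "s > 0" and m: "(\<lambda>n. real (m n) ^ 2 / real n) \<longlonglongrightarrow> s"
begin

lemma sq_mult_over_n: "(\<lambda>n. real (c * m n) ^ 2 / real n) \<longlonglongrightarrow> real c ^ 2 * s"
  using tendsto_mult_left[OF m, of "real c ^ 2"] by (simp add: power_mult_distrib)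

lemma mult_over_n: "(\<lambda>n. real (c * m n) / real n) \<longlonglongrightarrow> 0"
proof -
  have "(\<lambda>n. real (c * m n) ^ 2 / real n * (1 / real n)) \<longlonglongrightarrow> real c ^ 2 * s * 0"
    by (intro tendsto_mult sq_mult_over_n lim_1_over_n)
  then have "(\<lambda>n. sqrt (real (c * m n) ^ 2 / real n * (1 / real n))) \<longlonglongrightarrow> sqrt 0"
    by (intro tendsto_real_sqrt) simp
  moreover have "sqrt (real (c * m n) ^ 2 / real n * (1 / real n)) = real (c * m n) / real n" for n
  proof -
    have "real (c * m n) ^ 2 / real n * (1 / real n) = (real (c * m n) / real n) ^ 2"
      by (simp add: power_divide power2_eq_square)
    then show ?thesis by (simp only: real_sqrt_abs) simp
  qed
  ultimately show ?thesis by (simp only: real_sqrt_zero)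
qed

lemma binomial_side_tendsto:
  "(\<lambda>n. 1 + 2 * (\<Sum>j. real ((2 * n) choose (n + Suc j * m n)) / real ((2 * n) choose n))) \<longlonglongrightarrow> gauss_sum s"
proof (rule tendsto_gauss_sum)
  fix j
  let ?l = "\<lambda>n. Suc j * m n"
  have lt: "\<forall>\<^sub>F n in sequentially. real (?l n) / real n < 1 \<and> n > 0"
    by (intro eventually_conj order_tendstoD(2)[OF mult_over_n] eventually_gt_at_top) auto
  show "(\<lambda>n. real ((2 * n) choose (n + ?l n)) / real ((2 * n) choose n)) \<longlonglongrightarrow> exp (- (real (Suc j) ^ 2 * s))"
  proof (rule tendsto_sandwich)
    have "(\<lambda>n. exp (- (real (?l n) ^ 2 / real n / (1 - real (?l n) / real n)))) \<longlonglongrightarrow> exp (- (real (Suc j) ^ 2 * s / (1 - 0)))"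
      by (intro tendsto_intros sq_mult_over_n mult_over_n) auto
    then show "(\<lambda>n. exp (- (real (?l n) ^ 2 / real n / (1 - real (?l n) / real n)))) \<longlonglongrightarrow> exp (- (real (Suc j) ^ 2 * s))"
      by (simp only: diff_zero div_by_1)
    have "(\<lambda>n. exp (- (real (?l n) ^ 2 / real n / (1 + real (?l n) / real n)))) \<longlonglongrightarrow> exp (- (real (Suc j) ^ 2 * s / (1 + 0)))"
      by (intro tendsto_intros sq_mult_over_n mult_over_n) auto
    then show "(\<lambda>n. exp (- (real (?l n) ^ 2 / real n / (1 + real (?l n) / real n)))) \<longlonglongrightarrow> exp (- (real (Suc j) ^ 2 * s))"
      by (simp only: add_0_right div_by_1)
    show "\<forall>\<^sub>F n in sequentially. exp (- (real (?l n) ^ 2 / real n / (1 - real (?l n) / real n)))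
        \<le> real ((2 * n) choose (n + ?l n)) / real ((2 * n) choose n)"
      using lt
    proof eventually_elim
      case (elim n)
      then have "?l n < n" by (auto simp add: divide_less_eq_1 simp del: mult_Suc of_nat_mult)
      from central_binomial_ratio_lower[OF this] elim show ?case
        by (simp add: right_diff_distrib del: mult_Suc)
    qed
    show "\<forall>\<^sub>F n in sequentially. real ((2 * n) choose (n + ?l n)) / real ((2 * n) choose n)
        \<le> exp (- (real (?l n) ^ 2 / real n / (1 + real (?l n) / real n)))"
      using lt
    proof eventually_elim
      case (elim n)
      with central_binomial_ratio_upper[of n "?l n"] show ?case
        by (simp add: distrib_left del: mult_Suc)
    qed
  qed
next
  have "\<forall>\<^sub>F n in sequentially. real (m n) ^ 2 / real n > s / 2 \<and> n > 0"
    using s by (intro eventually_conj order_tendstoD(1)[OF m] eventually_gt_at_top) auto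
  then show "\<forall>\<^sub>F n in sequentially. \<forall>j. \<bar>real ((2 * n) choose (n + Suc j * m n)) / real ((2 * n) choose n)\<bar>
      \<le> exp (- (real (Suc j) ^ 2 * (s / 4)))"
  proof (eventually_elim, safe)
    fix n j assume n: "real (m n) ^ 2 / real n > s / 2" "n > 0"
    have "real (Suc j) ^ 2 * (s / 4) \<le> real (Suc j) ^ 2 * (real (m n) ^ 2 / real n / 2)"
    proof (rule mult_left_mono)
      have "s / 2 / 2 \<le> real (m n) ^ 2 / real n / 2"
        using n(1) by (intro divide_right_mono) auto
      then show "s / 4 \<le> real (m n) ^ 2 / real n / 2" by simp
    qed simp
    also have "\<dots> = real (Suc j * m n) ^ 2 / (2 * real n)"
      by (simp only: of_nat_mult power_mult_distrib) simp
    finally have "exp (- (real (Suc j * m n) ^ 2 / (2 * real n))) \<le> exp (- (real (Suc j) ^ 2 * (s / 4)))"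
      by (simp del: mult_Suc)
    from order_trans[OF central_binomial_ratio_upper'[OF n(2), of "Suc j * m n"] this]
    show "\<bar>real ((2 * n) choose (n + Suc j * m n)) / real ((2 * n) choose n)\<bar> \<le> exp (- (real (Suc j) ^ 2 * (s / 4)))"
      by (subst abs_of_nonneg) simp_all
  qed
qed (use s in simp)

lemma cosine_side_tendsto:
  assumes mp: "\<And>n. m n = 2 * p n + 1"
  shows "(\<lambda>n. 1 + 2 * (\<Sum>k. if k < p n then cos (pi * real (Suc k) / real (m n)) ^ (2 * n) else 0))
    \<longlonglongrightarrow> gauss_sum (pi ^ 2 / s)"
proof (rule tendsto_gauss_sum)
  have m_top: "filterlim (\<lambda>n. real (m n)) at_top sequentially"
  proof (rule filterlim_at_top_mono)
    show "filterlim (\<lambda>n. sqrt (s / 2) * sqrt (real n)) at_top sequentially"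
      using s by real_asymp
    have "\<forall>\<^sub>F n in sequentially. real (m n) ^ 2 / real n > s / 2 \<and> n > 0"
      using s by (intro eventually_conj order_tendstoD(1)[OF m] eventually_gt_at_top) auto
    then show "\<forall>\<^sub>F n in sequentially. sqrt (s / 2) * sqrt (real n) \<le> real (m n)"
    proof eventually_elim
      case (elim n)
      then have "s / 2 * real n \<le> real (m n) ^ 2" by (auto simp: less_divide_eq)
      then show ?case by (simp add: real_le_lsqrt flip: real_sqrt_mult)
    qed
  qed
  have inv: "(\<lambda>n. real n * (pi * real (Suc k) / real (m n)) ^ 2) \<longlonglongrightarrow> real (Suc k) ^ 2 * (pi ^ 2 / s)" for k
  proof -
    have "(\<lambda>n. real (Suc k) ^ 2 * (pi ^ 2 / (real (m n) ^ 2 / real n))) \<longlonglongrightarrow> real (Suc k) ^ 2 * (pi ^ 2 / s)"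
      using s by (intro tendsto_intros m) auto
    then show ?thesis by (simp add: power_divide power_mult_distrib mult_ac del: of_nat_Suc)
  qed
  fix k
  let ?x = "\<lambda>n. pi * real (Suc k) / real (m n)"
  have x0: "?x \<longlonglongrightarrow> 0"
    by (intro real_tendsto_divide_at_top[OF tendsto_const m_top])
  have "\<forall>\<^sub>F n in sequentially. real (m n) > 2 * real k + 2 \<and> ?x n < 1"
    using m_top by (intro eventually_conj order_tendstoD(2)[OF x0]) (auto simp: filterlim_at_top_dense)
  then have ev: "\<forall>\<^sub>F n in sequentially. k < p n \<and> 0 \<le> ?x n \<and> ?x n < 1 \<and> ?x n \<le> pi / 2"
  proof eventually_elim
    case (elim n)
    then have "k < p n" by (simp add: mp)
    moreover have "?x n \<le> pi / 2" using elim pi_ge_two by linarith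
    ultimately show ?case using elim by simp
  qed
  show "(\<lambda>n. if k < p n then cos (?x n) ^ (2 * n) else 0) \<longlonglongrightarrow> exp (- (real (Suc k) ^ 2 * (pi ^ 2 / s)))"
  proof (rule tendsto_sandwich)
    have "(\<lambda>n. exp (- (real n * ?x n ^ 2 / (1 - ?x n ^ 2 / 2)))) \<longlonglongrightarrow> exp (- (real (Suc k) ^ 2 * (pi ^ 2 / s) / (1 - 0 ^ 2 / 2)))"
      by (intro tendsto_intros inv x0) auto
    then show "(\<lambda>n. exp (- (real n * ?x n ^ 2 / (1 - ?x n ^ 2 / 2)))) \<longlonglongrightarrow> exp (- (real (Suc k) ^ 2 * (pi ^ 2 / s)))"
      by simp
    show "(\<lambda>n. exp (- (real n * ?x n ^ 2))) \<longlonglongrightarrow> exp (- (real (Suc k) ^ 2 * (pi ^ 2 / s)))"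
      by (intro tendsto_intros inv)
    show "\<forall>\<^sub>F n in sequentially. exp (- (real n * ?x n ^ 2 / (1 - ?x n ^ 2 / 2))) \<le> (if k < p n then cos (?x n) ^ (2 * n) else 0)"
      using ev by eventually_elim (use cos_power_lower in presburger)
    show "\<forall>\<^sub>F n in sequentially. (if k < p n then cos (?x n) ^ (2 * n) else 0) \<le> exp (- (real n * ?x n ^ 2))"
      using ev by eventually_elim (use cos_power_upper in presburger)
  qed
next
  have m0: "m n > 0" for n by (simp add: mp)
  have "\<forall>\<^sub>F n in sequentially. real (m n) ^ 2 / real n < 2 * s \<and> n > 0"
    using s by (intro eventually_conj order_tendstoD(2)[OF m] eventually_gt_at_top) auto
  then show "\<forall>\<^sub>F n in sequentially. \<forall>k. \<bar>if k < p n then cos (pi * real (Suc k) / real (m n)) ^ (2 * n) else 0\<bar>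
      \<le> exp (- (real (Suc k) ^ 2 * (pi ^ 2 / (2 * s))))"
  proof (eventually_elim, safe)
    fix n k assume n: "real (m n) ^ 2 / real n < 2 * s" "n > 0"
    let ?x = "pi * real (Suc k) / real (m n)"
    show "\<bar>if k < p n then cos ?x ^ (2 * n) else 0\<bar> \<le> exp (- (real (Suc k) ^ 2 * (pi ^ 2 / (2 * s))))"
    proof (cases "k < p n")
      case True
      then have "2 * real (Suc k) \<le> real (m n)" by (simp add: mp)
      from mult_left_mono[OF this, of pi] have x: "0 \<le> ?x" "?x \<le> pi / 2"
        using m0[of n] by (simp_all add: field_simps)
      have "pi ^ 2 / (2 * s) \<le> pi ^ 2 / (real (m n) ^ 2 / real n)"
        using n m0[of n] s by (intro divide_left_mono) auto
      then have "real (Suc k) ^ 2 * (pi ^ 2 / (2 * s)) \<le> real (Suc k) ^ 2 * (pi ^ 2 / (real (m n) ^ 2 / real n))"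
        by (intro mult_left_mono) auto
      also have "\<dots> = real n * ?x ^ 2"
        by (simp add: power_divide power_mult_distrib mult_ac del: of_nat_Suc)
      finally have "exp (- (real n * ?x ^ 2)) \<le> exp (- (real (Suc k) ^ 2 * (pi ^ 2 / (2 * s))))"
        by (simp del: of_nat_Suc)
      from order_trans[OF cos_power_upper[OF x, of n] this]
      have "\<bar>cos ?x ^ (2 * n)\<bar> \<le> exp (- (real (Suc k) ^ 2 * (pi ^ 2 / (2 * s))))"
        by (subst abs_of_nonneg) simp_all
      then show ?thesis using True by (simp only: if_True)
    qed simp
  qed
qed (use s in simp)

end

text \<open>
  The left-hand side does not mention s.  Hence the right-hand side is independent of s, and the
  asymptotics of the central binomial coefficient never have to be known.
\<close>

lemma gauss_sum_quotient_limit: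
  assumes s: "s > 0"
  shows "(\<lambda>n. sqrt (real n) * (real ((2 * n) choose n) / 4 ^ n)) \<longlonglongrightarrow> gauss_sum (pi ^ 2 / s) / gauss_sum s / sqrt s"
proof -
  \<comment> \<open>The modulus has to be odd and asymptotic to the square root of s n.\<close>
  define p where "p n = nat \<lfloor>sqrt (real n * s) / 2\<rfloor>" for n
  define m where "m n = 2 * p n + 1" for n
  have "(\<lambda>n. of_int \<lfloor>sqrt (real n * s) / 2\<rfloor> / sqrt (real n)) \<longlonglongrightarrow> s powr (1 / 2) / 2"
    using s by real_asymp
  moreover have "s powr (1 / 2) = sqrt s"
    using s by (simp add: powr_half_sqrt)
  moreover have "real (p n) = of_int \<lfloor>sqrt (real n * s) / 2\<rfloor>" for n
    unfolding p_def using s by (intro of_nat_nat) (simp add: zero_le_floor)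
  ultimately have "(\<lambda>n. real (p n) / sqrt (real n)) \<longlonglongrightarrow> sqrt s / 2" by simp
  moreover have "(\<lambda>n. 1 / sqrt (real n)) \<longlonglongrightarrow> 0" by real_asymp
  ultimately have "(\<lambda>n. 2 * (real (p n) / sqrt (real n)) + 1 / sqrt (real n)) \<longlonglongrightarrow> 2 * (sqrt s / 2) + 0"
    by (intro tendsto_add tendsto_mult_left)
  then have ms: "(\<lambda>n. real (m n) / sqrt (real n)) \<longlonglongrightarrow> sqrt s"
    by (simp add: m_def add_divide_distrib add.commute)
  from tendsto_power[OF this, of 2] have m: "(\<lambda>n. real (m n) ^ 2 / real n) \<longlonglongrightarrow> s"
    using s by (simp add: power_divide)
  let ?L = "\<lambda>n. 1 + 2 * (\<Sum>j. real ((2 * n) choose (n + Suc j * m n)) / real ((2 * n) choose n))"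
  let ?R = "\<lambda>n. 1 + 2 * (\<Sum>k. if k < p n then cos (pi * real (Suc k) / real (m n)) ^ (2 * n) else 0)"
  have g: "gauss_sum s \<noteq> 0" using gauss_sum_ge_1[OF s] by simp
  have L: "?L \<longlonglongrightarrow> gauss_sum s" by (rule binomial_side_tendsto[OF s m])
  have "(\<lambda>n. ?R n / ?L n / (real (m n) / sqrt (real n))) \<longlonglongrightarrow> gauss_sum (pi ^ 2 / s) / gauss_sum s / sqrt s"
    using s by (intro tendsto_divide ms L g cosine_side_tendsto[OF s m m_def]) auto
  moreover have "\<forall>\<^sub>F n in sequentially. ?R n / ?L n / (real (m n) / sqrt (real n)) = sqrt (real n) * (real ((2 * n) choose n) / 4 ^ n)"
  proof -
    have "\<forall>\<^sub>F n in sequentially. ?L n \<noteq> 0 \<and> n > 0"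
      by (intro eventually_conj tendsto_imp_eventually_ne[OF L g] eventually_gt_at_top)
    then show ?thesis
    proof eventually_elim
      case (elim n)
      let ?S = "\<Sum>j. real ((2 * n) choose (n + Suc j * m n))"
      have b: "real ((2 * n) choose n) > 0" by simp
      have "(\<Sum>j. real ((2 * n) choose (n + Suc j * m n)) / real ((2 * n) choose n)) = ?S / real ((2 * n) choose n)"
      proof (rule suminf_divide, rule summable_finite)
        fix j assume "j \<notin> {..<n}"
        then have "n \<le> j" by simp
        moreover have "Suc j \<le> Suc j * m n" by (simp add: m_def)
        ultimately have "2 * n < n + Suc j * m n" by linarith
        then show "real ((2 * n) choose (n + Suc j * m n)) = 0" by (simp only: binomial_eq_0)
      qed simp
      then have "real ((2 * n) choose n) * ?L n = real ((2 * n) choose n) + 2 * ?S"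
        using b by (simp add: distrib_left)
      also have "\<dots> = 4 ^ n / real (m n) * ?R n"
        by (rule sum_even_powers_cos[OF m_def])
      finally have e: "?R n = real ((2 * n) choose n) * ?L n * real (m n) / 4 ^ n"
        by (simp add: m_def)
      have m0: "real (m n) \<noteq> 0" by (simp add: m_def)
      show ?case unfolding e using elim m0 by simp
    qed
  qed
  ultimately show ?thesis by (rule Lim_transform_eventually)
qed

text \<open>
  At s = \<pi> the arguments s and \<pi>^2/s agree, and this evaluates the common value of the limits.
\<close>

lemma gauss_sum_inversion:
  assumes s: "s > 0"
  shows "gauss_sum (pi ^ 2 / s) = sqrt (s / pi) * gauss_sum s"
proof -
  have "gauss_sum (pi ^ 2 / s) / gauss_sum s / sqrt s = gauss_sum (pi ^ 2 / pi) / gauss_sum pi / sqrt pi"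
    by (rule LIMSEQ_unique[OF gauss_sum_quotient_limit gauss_sum_quotient_limit]) (use s in auto)
  also have "\<dots> = 1 / sqrt pi"
    using gauss_sum_ge_1[of pi] by (simp add: power2_eq_square)
  finally show ?thesis
    using gauss_sum_ge_1[OF s] s by (simp add: real_sqrt_divide field_simps)
qed

section \<open>The generating function of sums of squares\<close>

lemma has_sum_gauss_sum:
  assumes "s > 0"
  shows "((\<lambda>a::int. exp (- (s * real_of_int a ^ 2))) has_sum gauss_sum s) UNIV"
proof -
  let ?f = "\<lambda>a::int. exp (- (s * real_of_int a ^ 2))"
  let ?S = "\<Sum>j. exp (- (real (Suc j) ^ 2 * s))"
  have S: "((\<lambda>j. exp (- (real (Suc j) ^ 2 * s))) has_sum ?S) UNIV"
    using summable_gauss_sum[OF assms]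
    by (intro norm_summable_imp_has_sum summable_sums) simp_all
  have pos: "(?f has_sum ?S) (range (\<lambda>j. int (Suc j)))"
    using S by (subst has_sum_reindex) (auto intro!: injI simp: o_def mult.commute)
  have neg: "(?f has_sum ?S) (range (\<lambda>j. - int (Suc j)))"
    using S by (subst has_sum_reindex) (auto intro!: injI simp: o_def mult.commute power2_eq_square algebra_simps)
  have zero: "(?f has_sum 1) {0}"
    using has_sum_finite[of "{0}" ?f] by simp
  have "(?f has_sum (1 + (?S + ?S))) ({0} \<union> (range (\<lambda>j. int (Suc j)) \<union> range (\<lambda>j. - int (Suc j))))"
    by (intro has_sum_Un_disjoint pos neg zero) auto
  also have "{0} \<union> (range (\<lambda>j. int (Suc j)) \<union> range (\<lambda>j. - int (Suc j))) = UNIV"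
  proof (intro equalityI subsetI UNIV_I)
    fix a :: int
    consider "a = 0" | "a > 0" | "a < 0" by linarith
    then show "a \<in> {0} \<union> (range (\<lambda>j. int (Suc j)) \<union> range (\<lambda>j. - int (Suc j)))"
    proof cases
      case 2
      then have "a = int (Suc (nat (a - 1)))" by simp
      then show ?thesis by blast
    next
      case 3
      then have "a = - int (Suc (nat (- a - 1)))" by simp
      then show ?thesis by blast
    qed simp
  qed
  finally show ?thesis by (simp add: gauss_sum_def)
qed

text \<open>
  The k-th power of the Gaussian sum is a sum over k-tuples of integers, here lists of length k.
\<close>

lemma has_sum_gauss_sum_power:
  assumes "s > 0"
  shows "((\<lambda>m::int list. exp (- (s * real_of_int (\<Sum>a\<leftarrow>m. a ^ 2)))) has_sum gauss_sum s ^ k) {m. length m = k}"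
proof (induction k)
  case 0
  have "{m::int list. length m = 0} = {[]}" by auto
  then show ?case
    using has_sum_finite[of "{[]}" "\<lambda>m::int list. exp (- (s * real_of_int (\<Sum>a\<leftarrow>m. a ^ 2)))"] by simp
next
  case (Suc k)
  let ?g = "\<lambda>m::int list. exp (- (s * real_of_int (\<Sum>a\<leftarrow>m. a ^ 2)))"
  let ?L = "\<lambda>k. {m::int list. length m = k}"
  have g: "?g (a # m) = exp (- (s * real_of_int a ^ 2)) * ?g m" for a m
    by (simp add: algebra_simps flip: exp_add)
  have inner: "((\<lambda>m. ?g (fst (a, m) # snd (a, m))) has_sum exp (- (s * real_of_int a ^ 2)) * gauss_sum s ^ k) (?L k)" for a
    using has_sum_cmult_right[OF Suc.IH] by (simp only: g fst_conv snd_conv)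
  have outer: "((\<lambda>a::int. exp (- (s * real_of_int a ^ 2)) * gauss_sum s ^ k) has_sum gauss_sum s * gauss_sum s ^ k) UNIV"
    by (intro has_sum_cmult_left has_sum_gauss_sum assms)
  have "((\<lambda>p. ?g (fst p # snd p)) has_sum gauss_sum s * gauss_sum s ^ k) (UNIV \<times> ?L k)"
    by (rule has_sum_SigmaI[OF inner outer], rule summable_on_SigmaI[OF inner])
       (use outer in \<open>auto simp: summable_on_def\<close>)
  moreover have "bij_betw (\<lambda>p. fst p # snd p) (UNIV \<times> ?L k) (?L (Suc k))"
    by (rule bij_betw_byWitness[of _ "\<lambda>m. (hd m, tl m)"]) (auto simp: length_Suc_conv)
  ultimately show ?case
    using has_sum_reindex_bij_betw[of "\<lambda>p. fst p # snd p" "UNIV \<times> ?L k" "?L (Suc k)" ?g]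
    by (simp only: power_Suc)
qed

lemma finite_sum_squares: "finite {m :: int list. length m = k \<and> (\<Sum>a\<leftarrow>m. a ^ 2) = int n}"
proof (rule finite_subset)
  show "finite {m. set m \<subseteq> {- int n..int n} \<and> length m = k}"
    by (intro finite_lists_length_eq) simp
  show "{m :: int list. length m = k \<and> (\<Sum>a\<leftarrow>m. a ^ 2) = int n} \<subseteq> {m. set m \<subseteq> {- int n..int n} \<and> length m = k}"
  proof (intro subsetI CollectI conjI)
    fix m a assume m: "m \<in> {m :: int list. length m = k \<and> (\<Sum>a\<leftarrow>m. a ^ 2) = int n}" and a: "a \<in> set m"
    have "a ^ 2 \<le> (\<Sum>a\<leftarrow>m. a ^ 2)"
      using a by (intro member_le_sum_list) auto
    then have "a ^ 2 \<le> int n" using m by simp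
    moreover have "\<bar>a\<bar> \<le> a ^ 2"
      by (cases "a = 0") (auto simp: power2_eq_square abs_mult_self_eq[symmetric, of a] simp del: abs_mult_self_eq)
    ultimately show "a \<in> {- int n..int n}" by (auto simp: abs_le_iff)
  qed auto
qed

lemma rep_squares_0: "rep_squares k 0 = 1"
proof -
  have "{m :: int list. length m = k \<and> (\<Sum>a\<leftarrow>m. a ^ 2) = int 0} = {replicate k 0}"
  proof (intro equalityI subsetI)
    fix m :: "int list" assume "m \<in> {m. length m = k \<and> (\<Sum>a\<leftarrow>m. a ^ 2) = int 0}"
    then have m: "length m = k" "(\<Sum>a\<leftarrow>m. a ^ 2) = 0" by auto
    have "(\<Sum>a\<leftarrow>m. a ^ 2) = 0 \<longleftrightarrow> (\<forall>x \<in> set (map (\<lambda>a. a ^ 2) m). x = 0)"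
      by (rule sum_list_nonneg_eq_0_iff) auto
    with m show "m \<in> {replicate k 0}" by (auto intro: replicate_eqI)
  qed (simp add: sum_list_replicate)
  then show ?thesis by (simp add: rep_squares_def)
qed

text \<open>
  The sum over k-tuples, grouped by the value of the sum of squares.
\<close>

lemma rep_squares_generating_function:
  assumes "s > 0"
  shows "(\<lambda>n. real (rep_squares k n) * exp (- (s * real n))) sums gauss_sum s ^ k"
proof (rule has_sum_imp_sums, rule has_sum_SigmaD)
  let ?B = "\<lambda>n. {m :: int list. length m = k \<and> (\<Sum>a\<leftarrow>m. a ^ 2) = int n}"
  let ?g = "\<lambda>m::int list. exp (- (s * real_of_int (\<Sum>a\<leftarrow>m. a ^ 2)))"
  have "bij_betw snd (Sigma UNIV ?B) {m. length m = k}"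
  proof (rule bij_betw_byWitness[of _ "\<lambda>m. (nat (\<Sum>a\<leftarrow>m. a ^ 2), m)"])
    show "(\<lambda>m. (nat (\<Sum>a\<leftarrow>m. a ^ 2), m)) ` {m :: int list. length m = k} \<subseteq> Sigma UNIV ?B"
      by (auto intro!: sum_list_nonneg)
  qed auto
  then show "((\<lambda>p. ?g (snd p)) has_sum gauss_sum s ^ k) (Sigma UNIV ?B)"
    using has_sum_reindex_bij_betw[of snd "Sigma UNIV ?B" "{m. length m = k}" ?g]
      has_sum_gauss_sum_power[OF assms, of k] by blast
  fix n
  have "(\<Sum>m\<in>?B n. ?g (snd (n, m))) = (\<Sum>m\<in>?B n. exp (- (s * real n)))"
    by (intro sum.cong) auto
  also have "\<dots> = real (rep_squares k n) * exp (- (s * real n))"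
    by (simp add: rep_squares_def)
  finally show "((\<lambda>m. ?g (snd (n, m))) has_sum real (rep_squares k n) * exp (- (s * real n))) (?B n)"
    using has_sum_finite[OF finite_sum_squares[of k n], of "\<lambda>m. ?g (snd (n, m))"] by simp
qed

section \<open>Poisson's integral for the Bessel series\<close>

text \<open>
  The weight (1 - u^2)^(\<mu> - 1) on [-1, 1] of the Gegenbauer polynomials.  At the end points the real power
  of 0 is 0, also for \<mu> \<le> 1.
\<close>

definition gegenbauer_weight :: "real \<Rightarrow> real \<Rightarrow> real" where
  "gegenbauer_weight \<mu> u = indicator {-1..1} u * (1 - u ^ 2) powr (\<mu> - 1)"

definition gegenbauer_measure :: "real \<Rightarrow> real measure" where
  "gegenbauer_measure \<mu> = density lborel (\<lambda>u. ennreal (gegenbauer_weight \<mu> u))"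

lemma gegenbauer_weight_measurable [measurable]: "gegenbauer_weight \<mu> \<in> borel_measurable borel"
  unfolding gegenbauer_weight_def[abs_def] by measurable

lemma gegenbauer_weight_nonneg: "gegenbauer_weight \<mu> u \<ge> 0"
  by (simp add: gegenbauer_weight_def)

lemma sets_gegenbauer_measure [measurable_cong, simp]: "sets (gegenbauer_measure \<mu>) = sets borel"
  by (simp add: gegenbauer_measure_def)

lemma AE_gegenbauer_measure: "AE u in gegenbauer_measure \<mu>. u \<in> {-1..1}"
  unfolding gegenbauer_measure_def by (subst AE_density) (auto simp: gegenbauer_weight_def indicator_def)

lemma integral_gegenbauer_measure:
  fixes f :: "real \<Rightarrow> 'a :: {banach, second_countable_topology}"
  assumes [measurable]: "f \<in> borel_measurable borel"
  shows "integral\<^sup>L (gegenbauer_measure \<mu>) f = (\<integral>u. gegenbauer_weight \<mu> u *\<^sub>R f u \<partial>lborel)"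
  unfolding gegenbauer_measure_def by (rule integral_density) (auto simp: gegenbauer_weight_nonneg)

lemma integrable_gegenbauer_measure:
  fixes f :: "real \<Rightarrow> 'a :: {banach, second_countable_topology}"
  assumes [measurable]: "f \<in> borel_measurable borel"
  shows "integrable (gegenbauer_measure \<mu>) f \<longleftrightarrow> integrable lborel (\<lambda>u. gegenbauer_weight \<mu> u *\<^sub>R f u)"
  unfolding gegenbauer_measure_def by (rule integrable_density) (auto simp: gegenbauer_weight_nonneg)

text \<open>
  The substitution u = 2 t - 1 in Euler's Beta integral.
\<close>

lemma has_integral_gegenbauer_weight:
  assumes "\<mu> > 0"
  shows "((\<lambda>u. (1 - u ^ 2) powr (\<mu> - 1)) has_integral 2 * 4 powr (\<mu> - 1) * Beta \<mu> \<mu>) {-1..1::real}"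
proof -
  have "((\<lambda>t. t powr (\<mu> - 1) * (1 - t) powr (\<mu> - 1)) has_integral Beta \<mu> \<mu>) (cbox 0 1)"
    using has_integral_Beta_real[of \<mu> \<mu>] assms by simp
  from has_integral_affinity'[OF this, of "1 / 2" "1 / 2"]
  have "((\<lambda>u. ((u + 1) / 2) powr (\<mu> - 1) * (1 - (u + 1) / 2) powr (\<mu> - 1)) has_integral 2 * Beta \<mu> \<mu>) {-1..1}"
    by (simp add: add_divide_distrib)
  from has_integral_mult_right[OF this, of "4 powr (\<mu> - 1)"]
  have "((\<lambda>u. 4 powr (\<mu> - 1) * (((u + 1) / 2) powr (\<mu> - 1) * (1 - (u + 1) / 2) powr (\<mu> - 1)))
      has_integral 2 * 4 powr (\<mu> - 1) * Beta \<mu> \<mu>) {-1..1}"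
    by (simp add: mult_ac)
  then show ?thesis
  proof (rule has_integral_eq[rotated])
    fix u :: real assume "u \<in> {-1..1}"
    then have "4 powr (\<mu> - 1) * (((u + 1) / 2) powr (\<mu> - 1) * (1 - (u + 1) / 2) powr (\<mu> - 1))
        = (4 * ((u + 1) / 2 * (1 - (u + 1) / 2))) powr (\<mu> - 1)"
      by (simp add: powr_mult[symmetric] del: powr_mult)
    also have "4 * ((u + 1) / 2 * (1 - (u + 1) / 2)) = 1 - u ^ 2"
      by (simp add: field_simps power2_eq_square)
    finally show "4 powr (\<mu> - 1) * (((u + 1) / 2) powr (\<mu> - 1) * (1 - (u + 1) / 2) powr (\<mu> - 1))
        = (1 - u ^ 2) powr (\<mu> - 1)" .
  qed
qed

definition moment :: "real \<Rightarrow> nat \<Rightarrow> real" where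
  "moment \<mu> p = (\<integral>u. u ^ p \<partial>gegenbauer_measure \<mu>)"

text \<open>
  The factor that makes the constant terms agree in Poisson's integral for the Bessel series.
\<close>

definition poisson_const :: "real \<Rightarrow> real" where
  "poisson_const \<mu> = 1 / (Gamma (\<mu> + 1 / 2) * moment \<mu> 0)"

context
  fixes \<mu> :: real
  assumes \<mu>: "\<mu> > 0"
begin

lemma integrable_gegenbauer_weight: "integrable lborel (gegenbauer_weight \<mu>)"
proof -
  have "(\<lambda>u. (1 - u ^ 2) powr (\<mu> - 1)) absolutely_integrable_on {-1..1::real}"
    using has_integral_gegenbauer_weight[OF \<mu>] by (intro nonnegative_absolutely_integrable_1) auto
  then have "integrable lebesgue (gegenbauer_weight \<mu>)"
    by (simp add: set_integrable_def gegenbauer_weight_def[abs_def])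
  then show ?thesis by (simp add: integrable_completion)
qed

lemma finite_gegenbauer_measure: "finite_measure (gegenbauer_measure \<mu>)"
proof
  have "emeasure (gegenbauer_measure \<mu>) (space (gegenbauer_measure \<mu>)) = (\<integral>\<^sup>+u. ennreal (gegenbauer_weight \<mu> u) \<partial>lborel)"
    unfolding gegenbauer_measure_def by (subst emeasure_density) auto
  also have "\<dots> < \<infinity>"
    using integrable_gegenbauer_weight by (auto simp: integrable_iff_bounded gegenbauer_weight_nonneg)
  finally show "emeasure (gegenbauer_measure \<mu>) (space (gegenbauer_measure \<mu>)) \<noteq> \<infinity>" by simp
qed

lemma integrable_gegenbauer_bounded:
  fixes f :: "real \<Rightarrow> 'a :: {banach, second_countable_topology}"
  assumes "f \<in> borel_measurable borel" "\<And>u. \<bar>u\<bar> \<le> 1 \<Longrightarrow> norm (f u) \<le> B"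
  shows "integrable (gegenbauer_measure \<mu>) f"
proof (rule finite_measure.integrable_const_bound[OF finite_gegenbauer_measure])
  show "AE u in gegenbauer_measure \<mu>. norm (f u) \<le> B"
    using AE_gegenbauer_measure by eventually_elim (use assms(2) in auto)
qed (use assms in simp)

lemma integrable_power: "integrable (gegenbauer_measure \<mu>) (\<lambda>u. u ^ p)"
  by (rule integrable_gegenbauer_bounded[of _ 1]) (auto simp: power_le_one_iff abs_power_minus power_abs power_le_one)

lemma integral_gegenbauer_measure_eq_integral:
  fixes f :: "real \<Rightarrow> real"
  assumes [measurable]: "f \<in> borel_measurable borel" and "integrable (gegenbauer_measure \<mu>) f"
    and "((\<lambda>u. (1 - u ^ 2) powr (\<mu> - 1) * f u) has_integral I) {-1..1}"
  shows "integral\<^sup>L (gegenbauer_measure \<mu>) f = I"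
proof -
  have "set_integrable lborel {-1..1} (\<lambda>u. (1 - u ^ 2) powr (\<mu> - 1) * f u)"
    using assms(2) by (simp add: integrable_gegenbauer_measure set_integrable_def gegenbauer_weight_def mult.assoc)
  from set_borel_integral_eq_integral(2)[OF this] integral_unique[OF assms(3)]
  show ?thesis
    by (simp add: integral_gegenbauer_measure set_lebesgue_integral_def gegenbauer_weight_def mult.assoc)
qed

lemma moment_0_pos: "moment \<mu> 0 > 0"
proof -
  have "moment \<mu> 0 = 2 * 4 powr (\<mu> - 1) * Beta \<mu> \<mu>"
    unfolding moment_def using has_integral_gegenbauer_weight[OF \<mu>]
    by (intro integral_gegenbauer_measure_eq_integral integrable_power) auto
  also have "\<dots> > 0" using \<mu> by (simp add: Beta_def)
  finally show ?thesis .
qed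

text \<open>
  The integral of the derivative of u^p (1 - u^2)^\<mu>, which vanishes at both end points.  For p = 0 the
  left-hand side is 0, so that the first moment vanishes.
\<close>

lemma moment_rec: "real p * moment \<mu> (p - 1) = (real p + 2 * \<mu>) * moment \<mu> (p + 1)"
proof -
  have "continuous_on {-1..1} (\<lambda>u::real. u ^ p * (1 - u ^ 2) powr \<mu>)"
    using \<mu> by (intro continuous_intros continuous_on_powr') (auto simp: abs_square_le_1)
  moreover have "((\<lambda>u. u ^ p * (1 - u ^ 2) powr \<mu>) has_vector_derivative
      (1 - u ^ 2) powr (\<mu> - 1) * (real p * u ^ (p - 1) - (real p + 2 * \<mu>) * u ^ (p + 1))) (at u)"
    if "u \<in> {-1<..<1}" for u :: real
  proof -
    have u: "1 - u ^ 2 > 0" using that by (simp add: abs_square_less_1 abs_less_iff)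
    have "(1 - u ^ 2) powr \<mu> = (1 - u ^ 2) powr (\<mu> - 1) * (1 - u ^ 2)"
      using u by (simp add: powr_diff)
    then have eq: "real p * u ^ (p - 1) * (1 - u ^ 2) powr \<mu> + u ^ p * (\<mu> * (1 - u ^ 2) powr (\<mu> - 1) * (- (2 * u)))
       = (1 - u ^ 2) powr (\<mu> - 1) * (real p * u ^ (p - 1) - (real p + 2 * \<mu>) * u ^ (p + 1))"
      by (simp only:) (cases p; simp add: algebra_simps power2_eq_square)
    have "((\<lambda>u. u ^ p * (1 - u ^ 2) powr \<mu>) has_real_derivative
        real p * u ^ (p - 1) * (1 - u ^ 2) powr \<mu> + u ^ p * (\<mu> * (1 - u ^ 2) powr (\<mu> - 1) * (- (2 * u)))) (at u)"
      using u by (auto intro!: derivative_eq_intros DERIV_powr)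
    then show ?thesis
      unfolding has_real_derivative_iff_has_vector_derivative[symmetric] eq .
  qed
  ultimately have "((\<lambda>u. (1 - u ^ 2) powr (\<mu> - 1) * (real p * u ^ (p - 1) - (real p + 2 * \<mu>) * u ^ (p + 1))) has_integral
      (1 ^ p * (1 - 1 ^ 2) powr \<mu> - (- 1) ^ p * (1 - (- 1) ^ 2) powr \<mu>)) {-1..1::real}"
    by (intro fundamental_theorem_of_calculus_interior) auto
  then have "0 = (\<integral>u. real p * u ^ (p - 1) - (real p + 2 * \<mu>) * u ^ (p + 1) \<partial>gegenbauer_measure \<mu>)"
    by (intro integral_gegenbauer_measure_eq_integral[symmetric] Bochner_Integration.integrable_diff
        integrable_mult_right integrable_power) simp_all
  also have "(\<integral>u. real p * u ^ (p - 1) - (real p + 2 * \<mu>) * u ^ (p + 1) \<partial>gegenbauer_measure \<mu>)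
      = real p * moment \<mu> (p - 1) - (real p + 2 * \<mu>) * moment \<mu> (p + 1)"
    unfolding moment_def integral_mult_right_zero[symmetric]
    by (intro Bochner_Integration.integral_diff integrable_mult_right integrable_power)
  finally show ?thesis by simp
qed

lemma moment_odd: "moment \<mu> (2 * j + 1) = 0"
proof (induction j)
  case 0
  show ?case using moment_rec[of 0] \<mu> by simp
next
  case (Suc j)
  have "(real (2 * j + 2) + 2 * \<mu>) * moment \<mu> (2 * Suc j + 1) = 0"
    using moment_rec[of "2 * j + 2"] Suc.IH by simp
  moreover have "real (2 * j + 2) + 2 * \<mu> > 0" using \<mu> by simp
  ultimately show ?case by simp
qed

lemma moment_even:
  "moment \<mu> (2 * j) * (4 ^ j * fact j * Gamma (\<mu> + 1 / 2 + real j)) = moment \<mu> 0 * Gamma (\<mu> + 1 / 2) * fact (2 * j)"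
proof (induction j)
  case (Suc j)
  have rec: "(real (2 * j + 1) + 2 * \<mu>) * moment \<mu> (2 * Suc j) = real (2 * j + 1) * moment \<mu> (2 * j)"
    using moment_rec[of "2 * j + 1"] by simp
  have G: "Gamma (\<mu> + 1 / 2 + real (Suc j)) = (\<mu> + 1 / 2 + real j) * Gamma (\<mu> + 1 / 2 + real j)"
    using Gamma_plus1[of "\<mu> + 1 / 2 + real j"] \<mu> nonpos_Ints_nonpos[of "\<mu> + 1 / 2 + real j"]
    by (force simp: add_ac)
  have "moment \<mu> (2 * Suc j) * (4 ^ Suc j * fact (Suc j) * Gamma (\<mu> + 1 / 2 + real (Suc j)))
     = ((real (2 * j + 1) + 2 * \<mu>) * moment \<mu> (2 * Suc j)) * (2 * 4 ^ j * (real (Suc j) * fact j) * Gamma (\<mu> + 1 / 2 + real j))"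
    unfolding G by (simp add: algebra_simps)
  also have "\<dots> = (moment \<mu> (2 * j) * (4 ^ j * fact j * Gamma (\<mu> + 1 / 2 + real j))) * (real (2 * j + 1) * (2 * real (Suc j)))"
    unfolding rec by (simp only: mult_ac)
  also have "\<dots> = moment \<mu> 0 * Gamma (\<mu> + 1 / 2) * (fact (2 * j) * (real (2 * j + 1) * (2 * real (Suc j))))"
    unfolding Suc.IH by (simp only: mult_ac)
  also have "fact (2 * j) * (real (2 * j + 1) * (2 * real (Suc j))) = fact (2 * Suc j)"
    by (simp add: algebra_simps)
  finally show ?case .
qed simp

lemma poisson_const_pos: "poisson_const \<mu> > 0"
  unfolding poisson_const_def using moment_0_pos \<mu> by (simp add: Gamma_real_pos)

lemma exp_integral_sums:
  fixes z :: complex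
  shows "(\<lambda>n. z ^ n / fact n * of_real (moment \<mu> n)) sums (\<integral>u. exp (z * of_real u) \<partial>gegenbauer_measure \<mu>)"
proof -
  let ?M = "gegenbauer_measure \<mu>"
  let ?f = "\<lambda>n u. (z * of_real u) ^ n / fact n"
  have int: "integrable ?M (?f n)" for n
    by (rule integrable_gegenbauer_bounded[of _ "norm z ^ n / fact n"])
       (auto simp: norm_divide norm_power norm_mult intro!: divide_right_mono power_mono mult_left_le)
  have "(\<lambda>n. integral\<^sup>L ?M (?f n)) sums (\<integral>u. (\<Sum>n. ?f n u) \<partial>?M)"
  proof (rule sums_integral[OF int])
    show "AE u in ?M. summable (\<lambda>n. norm (?f n u))"
      using summable_norm_exp[of "z * of_real u" for u] by (simp add: divide_inverse norm_mult norm_power norm_inverse mult_ac scaleR_conv_of_real)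
    have "summable (\<lambda>n. norm z ^ n / fact n * moment \<mu> 0)"
      using summable_exp[of "norm z"] by (intro summable_mult2) (simp add: divide_inverse mult.commute)
    then show "summable (\<lambda>n. \<integral>u. norm (?f n u) \<partial>?M)"
    proof (rule summable_comparison_test'[of _ 0])
      fix n
      have "(\<integral>u. norm (?f n u) \<partial>?M) \<le> (\<integral>u. norm z ^ n / fact n * u ^ 0 \<partial>?M)"
      proof (rule integral_mono_AE)
        show "AE u in ?M. norm (?f n u) \<le> norm z ^ n / fact n * u ^ 0"
          using AE_gegenbauer_measure by eventually_elim
            (auto simp: norm_divide norm_power norm_mult abs_le_iff intro!: divide_right_mono power_mono mult_left_le)
      qed (use int integrable_gegenbauer_bounded[of "\<lambda>_. norm z ^ n / fact n" "norm z ^ n / fact n"] in auto)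
      also have "\<dots> = norm z ^ n / fact n * moment \<mu> 0"
        by (simp add: moment_def)
      finally show "norm (\<integral>u. norm (?f n u) \<partial>?M) \<le> norm z ^ n / fact n * moment \<mu> 0"
        by (simp add: integral_nonneg_AE)
    qed
  qed
  moreover have "(\<Sum>n. ?f n u) = exp (z * of_real u)" for u
    by (simp add: exp_def scaleR_conv_of_real divide_inverse mult.commute)
  moreover have "integral\<^sup>L ?M (?f n) = z ^ n / fact n * of_real (moment \<mu> n)" for n
  proof -
    have "integral\<^sup>L ?M (?f n) = (\<integral>u. z ^ n / fact n * of_real (u ^ n) \<partial>?M)"
      by (simp add: power_mult_distrib)
    then show ?thesis by (simp only: integral_mult_right_zero integral_complex_of_real moment_def)
  qed
  ultimately show ?thesis by simp
qed

text \<open>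
  Poisson's integral: the exponential is integrated term by term.  The odd moments vanish, and the even
  ones reproduce the coefficients of the Bessel series.
\<close>

lemma bessel_I_series_sums:
  fixes z :: complex
  defines "\<nu> \<equiv> of_real \<mu> - 1 / 2"
  shows "(\<lambda>j. (z / 2) ^ (2 * j) / (fact j * Gamma (\<nu> + of_nat j + 1)))
    sums (of_real (poisson_const \<mu>) * (\<integral>u. exp (z * of_real u) \<partial>gegenbauer_measure \<mu>))"
proof -
  have "(\<lambda>n. z ^ n / fact n * of_real (moment \<mu> n)) sums (\<integral>u. exp (z * of_real u) \<partial>gegenbauer_measure \<mu>)"
    by (rule exp_integral_sums)
  then have "(\<lambda>j. z ^ (2 * j) / fact (2 * j) * of_real (moment \<mu> (2 * j))) sums (\<integral>u. exp (z * of_real u) \<partial>gegenbauer_measure \<mu>)"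
  proof (subst sums_mono_reindex[of "\<lambda>j. 2 * j"])
    fix n :: nat assume "n \<notin> range (\<lambda>j. 2 * j)"
    then have "odd n" by (auto elim!: evenE)
    then show "z ^ n / fact n * complex_of_real (moment \<mu> n) = 0"
      by (auto elim!: oddE simp: moment_odd[simplified])
  qed (auto simp: strict_mono_def)
  from sums_mult[OF this, of "of_real (poisson_const \<mu>)"]
  have "(\<lambda>j. of_real (poisson_const \<mu>) * (z ^ (2 * j) / fact (2 * j) * of_real (moment \<mu> (2 * j))))
    sums (of_real (poisson_const \<mu>) * (\<integral>u. exp (z * of_real u) \<partial>gegenbauer_measure \<mu>))" .
  moreover have "of_real (poisson_const \<mu>) * (z ^ (2 * j) / fact (2 * j) * of_real (moment \<mu> (2 * j)))
     = (z / 2) ^ (2 * j) / (fact j * Gamma (\<nu> + of_nat j + 1))" for j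
  proof -
    have G: "Gamma (\<nu> + of_nat j + 1) = of_real (Gamma (\<mu> + 1 / 2 + real j))"
      by (subst Gamma_complex_of_real[symmetric]) (simp add: \<nu>_def algebra_simps)
    have pos: "Gamma (\<mu> + 1 / 2 + real j) > 0" "Gamma (\<mu> + 1 / 2) > 0"
      using \<mu> by (auto intro!: Gamma_real_pos)
    have "poisson_const \<mu> * moment \<mu> (2 * j) / fact (2 * j) = 1 / (4 ^ j * (fact j * Gamma (\<mu> + 1 / 2 + real j)))"
      using moment_even[of j] moment_0_pos pos by (simp add: poisson_const_def field_simps)
    from arg_cong[OF this, of complex_of_real]
    have eq: "of_real (poisson_const \<mu>) * of_real (moment \<mu> (2 * j)) / fact (2 * j)
        = (1 / (4 ^ j * (fact j * of_real (Gamma (\<mu> + 1 / 2 + real j)))) :: complex)"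
      by simp
    have "of_real (poisson_const \<mu>) * (z ^ (2 * j) / fact (2 * j) * of_real (moment \<mu> (2 * j)))
       = z ^ (2 * j) * (of_real (poisson_const \<mu>) * of_real (moment \<mu> (2 * j)) / fact (2 * j))"
      by simp
    also have "\<dots> = z ^ (2 * j) * (1 / (4 ^ j * (fact j * of_real (Gamma (\<mu> + 1 / 2 + real j)))))"
      unfolding eq ..
    finally have "of_real (poisson_const \<mu>) * (z ^ (2 * j) / fact (2 * j) * of_real (moment \<mu> (2 * j)))
       = z ^ (2 * j) * (1 / (4 ^ j * (fact j * of_real (Gamma (\<mu> + 1 / 2 + real j)))))" .
    then show ?thesis by (simp add: G power_divide power_mult)
  qed
  ultimately show ?thesis by simp
qed

lemma bessel_I_series_integral:
  "bessel_I_series (of_real \<mu> - 1 / 2) z = of_real (poisson_const \<mu>) * (\<integral>u. exp (z * of_real u) \<partial>gegenbauer_measure \<mu>)"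
  unfolding bessel_I_series_def using bessel_I_series_sums by (rule sums_unique[symmetric])

lemma integrable_exp_gegenbauer: "integrable (gegenbauer_measure \<mu>) (\<lambda>u. exp (z * complex_of_real u))"
proof (rule integrable_gegenbauer_bounded[of _ "exp (norm z)"])
  fix u :: real assume u: "\<bar>u\<bar> \<le> 1"
  have "norm (exp (z * complex_of_real u)) \<le> exp (norm (z * complex_of_real u))" by (rule norm_exp)
  also have "\<dots> \<le> exp (norm z)" using u by (simp add: norm_mult mult_left_le)
  finally show "norm (exp (z * complex_of_real u)) \<le> exp (norm z)" .
qed measurable

text \<open>
  This growth bound follows from the integral and is what makes the series with Re x > |Re y| converge; the power series
  alone only shows a bound by exp |z|.
\<close>

lemma norm_bessel_I_series_le:
  "norm (bessel_I_series (of_real \<mu> - 1 / 2) z) \<le> poisson_const \<mu> * moment \<mu> 0 * exp \<bar>Re z\<bar>"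
proof -
  let ?M = "gegenbauer_measure \<mu>"
  have "norm (\<integral>u. exp (z * of_real u) \<partial>?M) \<le> (\<integral>u. norm (exp (z * complex_of_real u)) \<partial>?M)"
    by (rule integral_norm_bound)
  also have "\<dots> \<le> (\<integral>u. exp \<bar>Re z\<bar> * u ^ 0 \<partial>?M)"
  proof (rule integral_mono_AE)
    show "AE u in ?M. norm (exp (z * complex_of_real u)) \<le> exp \<bar>Re z\<bar> * u ^ 0"
      using AE_gegenbauer_measure
    proof eventually_elim
      case (elim u)
      then have "\<bar>Re z * u\<bar> \<le> \<bar>Re z\<bar>" by (simp add: abs_mult mult_left_le abs_le_iff)
      then show ?case by (simp add: norm_exp_eq_Re)
    qed
  qed (use integrable_norm[OF integrable_exp_gegenbauer] integrable_gegenbauer_bounded[of "\<lambda>_. exp \<bar>Re z\<bar>" "exp \<bar>Re z\<bar>"] in auto)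
  also have "\<dots> = moment \<mu> 0 * exp \<bar>Re z\<bar>" by (simp add: moment_def)
  finally show ?thesis
    using poisson_const_pos by (simp add: bessel_I_series_integral norm_mult mult.assoc)
qed

lemma bessel_I_series_of_real:
  "bessel_I_series (of_real \<mu> - 1 / 2) (of_real y) = of_real (poisson_const \<mu> * (\<integral>u. exp (y * u) \<partial>gegenbauer_measure \<mu>))"
  unfolding bessel_I_series_integral
proof -
  have "exp (complex_of_real y * complex_of_real u) = complex_of_real (exp (y * u))" for u
    by (simp flip: exp_of_real)
  then show "of_real (poisson_const \<mu>) * (\<integral>u. exp (of_real y * of_real u) \<partial>gegenbauer_measure \<mu>)
      = complex_of_real (poisson_const \<mu> * (\<integral>u. exp (y * u) \<partial>gegenbauer_measure \<mu>))"
    by (simp only: integral_complex_of_real of_real_mult)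
qed

lemma bessel_I_series_holomorphic: "bessel_I_series (of_real \<mu> - 1 / 2) holomorphic_on A"
proof -
  let ?a = "\<lambda>n. complex_of_real (poisson_const \<mu> * moment \<mu> n / fact n)"
  have "bessel_I_series (of_real \<mu> - 1 / 2) holomorphic_on ball 0 (norm z + 1)" for z
  proof (rule power_series_holomorphic)
    fix w :: complex
    show "(\<lambda>n. ?a n * (w - 0) ^ n) sums bessel_I_series (of_real \<mu> - 1 / 2) w"
      using sums_mult[OF exp_integral_sums[of w], of "of_real (poisson_const \<mu>)"]
      by (simp add: bessel_I_series_integral mult_ac)
  qed
  then have "bessel_I_series (of_real \<mu> - 1 / 2) field_differentiable at z" for z
    by (rule holomorphic_on_imp_differentiable_at[of _ "ball 0 (norm z + 1)"]) auto
  then show ?thesis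
    by (auto simp: holomorphic_on_def intro: field_differentiable_at_within)
qed

lemma bessel_I_series_0: "bessel_I_series (of_real \<mu> - 1 / 2) 0 = 1 / of_real (Gamma (\<mu> + 1 / 2))"
  using bessel_I_series_of_real[of 0] moment_0_pos by (simp add: poisson_const_def moment_def)

end

lemma bessel_I_series_minus: "bessel_I_series \<nu> (- z) = bessel_I_series \<nu> z"
  by (simp add: bessel_I_series_def power_mult)

lemma bessel_J_series_eq_I: "bessel_J_series \<nu> z = bessel_I_series \<nu> (\<i> * z)"
proof -
  have "(\<i> * z / 2) ^ (2 * j) = (- 1) ^ j * (z / 2) ^ (2 * j)" for j
  proof -
    have "(\<i> * z / 2) ^ 2 = - 1 * (z / 2) ^ 2" by (simp add: power_divide power_mult_distrib)
    then show ?thesis by (simp only: power_mult power_mult_distrib)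
  qed
  then show ?thesis by (simp only: bessel_J_series_def bessel_I_series_def)
qed

section \<open>The transformation formula\<close>

text \<open>
  For s > 0 this is \<theta>(s/\<pi>)^k.  The series is used for every real s, because this
  gives a Borel function on the whole line.
\<close>

definition theta_power :: "nat \<Rightarrow> real \<Rightarrow> real" where
  "theta_power k s = (\<Sum>n. real (rep_squares k n) * exp (- (s * real n)))"

lemma theta_power_measurable [measurable]: "theta_power k \<in> borel_measurable borel"
  unfolding theta_power_def[abs_def] by measurable

lemma summable_rep_squares:
  "s > 0 \<Longrightarrow> summable (\<lambda>n. real (rep_squares k n) * exp (- (s * real n)))"
  using rep_squares_generating_function by (rule sums_summable)

lemma theta_power_inversion:
  assumes "s > 0"
  shows "theta_power k (pi / s) = s powr (real k / 2) * theta_power k (pi * s)"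
proof -
  have eq: "theta_power k t = gauss_sum t ^ k" if "t > 0" for t
    unfolding theta_power_def using rep_squares_generating_function[OF that] by (rule sums_unique[symmetric])
  have "gauss_sum (pi / s) = sqrt s * gauss_sum (pi * s)"
    using gauss_sum_inversion[of "pi * s"] assms by (simp add: power2_eq_square)
  moreover have "sqrt s ^ k = s powr (real k / 2)"
    using assms by (simp add: powr_half_sqrt[symmetric] powr_realpow[symmetric] powr_powr)
  ultimately show ?thesis
    using assms by (simp add: eq power_mult_distrib)
qed

text \<open>
  The summands without the factor (\<pi> y/2)^\<nu>.  They are entire functions of x and y, so no branch of a
  power of y interferes with the analytic continuation.
\<close>

definition theta_bessel_term :: "nat \<Rightarrow> complex \<Rightarrow> complex \<Rightarrow> nat \<Rightarrow> complex" where
  "theta_bessel_term k x y n = of_nat (rep_squares k n) * exp (- (of_real pi * of_nat n * x))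
     * bessel_I_series (of_nat k / 4 - 1 / 2) (of_real pi * of_nat n * y)"

definition theta_bessel :: "nat \<Rightarrow> complex \<Rightarrow> complex \<Rightarrow> complex" where
  "theta_bessel k x y = (\<Sum>n. theta_bessel_term k x y n)"

lemma theta_bessel_minus: "theta_bessel k x (- y) = theta_bessel k x y"
  unfolding theta_bessel_def theta_bessel_term_def mult_minus_right bessel_I_series_minus ..

text \<open>
  Both x + y and x - y lie in the right half-plane, hence so do their inverses, which are (x - y)/w and
  (x + y)/w for w = x^2 - y^2; and a product of two numbers in the right half-plane is not on the closed negative axis.
\<close>

lemma Re_quotient_domain:
  assumes "\<bar>Re y\<bar> < Re x"
  shows "x ^ 2 - y ^ 2 \<notin> \<real>\<^sub>\<le>\<^sub>0" and "x ^ 2 - y ^ 2 \<noteq> 0"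
    and "\<bar>Re (y / (x ^ 2 - y ^ 2))\<bar> < Re (x / (x ^ 2 - y ^ 2))"
proof -
  define a where "a = x + y"
  define b where "b = x - y"
  have ab: "Re a > 0" "Re b > 0" using assms by (auto simp: a_def b_def abs_less_iff)
  have w: "x ^ 2 - y ^ 2 = a * b" by (simp add: a_def b_def power2_eq_square algebra_simps)
  show "x ^ 2 - y ^ 2 \<notin> \<real>\<^sub>\<le>\<^sub>0"
  proof
    assume "x ^ 2 - y ^ 2 \<in> \<real>\<^sub>\<le>\<^sub>0"
    then have re: "Re a * Re b \<le> Im a * Im b" and im: "Re a * Im b = - (Im a * Re b)"
      unfolding w complex_nonpos_Reals_iff by simp_all
    have "Re a * (Im a * Im b) = - (Im a ^ 2 * Re b)"
      using im by (simp add: power2_eq_square mult.left_commute)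
    also have "\<dots> \<le> 0" using ab by simp
    finally have "Im a * Im b \<le> 0" using ab by (simp add: mult_le_0_iff)
    with re have "Re a * Re b \<le> 0" by linarith
    moreover have "Re a * Re b > 0" using ab by simp
    ultimately show False by linarith
  qed
  have ab0: "a \<noteq> 0" "b \<noteq> 0" using ab by auto
  then show "x ^ 2 - y ^ 2 \<noteq> 0" unfolding w by simp
  have "(x + y) / (x ^ 2 - y ^ 2) = 1 / b" "(x - y) / (x ^ 2 - y ^ 2) = 1 / a"
    using ab0 unfolding w a_def[symmetric] b_def[symmetric] by simp_all
  moreover have "Re (1 / a) > 0" "Re (1 / b) > 0"
    using ab by (auto simp: Re_divide power2_eq_square intro!: divide_pos_pos add_pos_nonneg)
  ultimately have "Re ((x + y) / (x ^ 2 - y ^ 2)) > 0" "Re ((x - y) / (x ^ 2 - y ^ 2)) > 0"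
    by simp_all
  then show "\<bar>Re (y / (x ^ 2 - y ^ 2))\<bar> < Re (x / (x ^ 2 - y ^ 2))"
    by (simp add: add_divide_distrib diff_divide_distrib abs_less_iff)
qed

context
  fixes k :: nat and \<mu> :: real
  assumes k: "k \<ge> 1" and \<mu>_def: "\<mu> = real k / 4"
begin

lemma \<mu>_pos: "\<mu> > 0" using k by (simp add: \<mu>_def)

lemma order_eq: "of_nat k / 4 - 1 / 2 = complex_of_real \<mu> - 1 / 2"
  by (simp add: \<mu>_def)

lemma norm_theta_bessel_term_le:
  assumes "\<delta> \<le> Re x - \<bar>Re y\<bar>"
  shows "norm (theta_bessel_term k x y n)
    \<le> real (rep_squares k n) * exp (- (pi * \<delta> * real n)) * (poisson_const \<mu> * moment \<mu> 0)"
proof -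
  have "norm (theta_bessel_term k x y n) = real (rep_squares k n) * exp (- (pi * real n * Re x))
      * norm (bessel_I_series (of_real \<mu> - 1 / 2) (of_real pi * of_nat n * y))"
    by (simp add: theta_bessel_term_def norm_mult norm_exp_eq_Re order_eq)
  also have "\<dots> \<le> real (rep_squares k n) * exp (- (pi * real n * Re x))
      * (poisson_const \<mu> * moment \<mu> 0 * exp \<bar>Re (of_real pi * of_nat n * y)\<bar>)"
    by (intro mult_left_mono norm_bessel_I_series_le \<mu>_pos) auto
  also have "\<bar>Re (of_real pi * of_nat n * y)\<bar> = pi * real n * \<bar>Re y\<bar>"
    by (simp add: abs_mult)
  also have "real (rep_squares k n) * exp (- (pi * real n * Re x)) * (poisson_const \<mu> * moment \<mu> 0 * exp (pi * real n * \<bar>Re y\<bar>))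
     = real (rep_squares k n) * exp (- (pi * (Re x - \<bar>Re y\<bar>) * real n)) * (poisson_const \<mu> * moment \<mu> 0)"
    by (simp add: algebra_simps flip: exp_add)
  also have "\<dots> \<le> real (rep_squares k n) * exp (- (pi * \<delta> * real n)) * (poisson_const \<mu> * moment \<mu> 0)"
    using assms moment_0_pos[OF \<mu>_pos] poisson_const_pos[OF \<mu>_pos]
    by (intro mult_right_mono mult_left_mono) (auto intro!: mult_right_mono mult_left_mono)
  finally show ?thesis .
qed

lemma summable_theta_bessel_bound:
  "\<delta> > 0 \<Longrightarrow> summable (\<lambda>n. real (rep_squares k n) * exp (- (pi * \<delta> * real n)) * (poisson_const \<mu> * moment \<mu> 0))"
  by (intro summable_mult2 summable_rep_squares) simp

lemma summable_theta_bessel: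
  assumes "\<bar>Re y\<bar> < Re x"
  shows "summable (theta_bessel_term k x y)"
  by (rule summable_comparison_test'[OF summable_theta_bessel_bound norm_theta_bessel_term_le, of "Re x - \<bar>Re y\<bar>"])
     (use assms in auto)

text \<open>
  Near every point Re X - |Re Y| stays above a positive \<delta>, and the generating function at \<pi> \<delta> is a majorant.
\<close>

lemma theta_bessel_holomorphic:
  assumes U: "open U" and X: "X holomorphic_on U" and Y: "Y holomorphic_on U"
    and dom: "\<And>\<tau>. \<tau> \<in> U \<Longrightarrow> \<bar>Re (Y \<tau>)\<bar> < Re (X \<tau>)"
  shows "(\<lambda>\<tau>. theta_bessel k (X \<tau>) (Y \<tau>)) holomorphic_on U"
proof (rule holomorphic_uniform_sequence[OF U])
  let ?f = "\<lambda>n \<tau>. theta_bessel_term k (X \<tau>) (Y \<tau>) n"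
  have "(bessel_I_series (of_real \<mu> - 1 / 2) \<circ> (\<lambda>\<tau>. of_real pi * of_nat n * Y \<tau>)) holomorphic_on U" for n
    by (rule holomorphic_on_compose_gen[OF _ bessel_I_series_holomorphic[OF \<mu>_pos, of UNIV]])
       (auto intro!: holomorphic_intros Y)
  then have "?f n holomorphic_on U" for n
    unfolding theta_bessel_term_def order_eq by (intro holomorphic_intros X) (simp add: o_def)
  then show "(\<lambda>\<tau>. \<Sum>n<N. ?f n \<tau>) holomorphic_on U" for N
    by (intro holomorphic_intros)
  fix \<tau>0 assume \<tau>0: "\<tau>0 \<in> U"
  define \<delta> where "\<delta> = (Re (X \<tau>0) - \<bar>Re (Y \<tau>0)\<bar>) / 2"
  have \<delta>: "\<delta> > 0" using dom[OF \<tau>0] by (simp add: \<delta>_def)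
  define V where "V = {\<tau> \<in> U. \<delta> < Re (X \<tau>) - \<bar>Re (Y \<tau>)\<bar>}"
  have "continuous_on U (\<lambda>\<tau>. Re (X \<tau>) - \<bar>Re (Y \<tau>)\<bar>)"
    by (intro continuous_intros holomorphic_on_imp_continuous_on X Y)
  then have "open (U \<inter> (\<lambda>\<tau>. Re (X \<tau>) - \<bar>Re (Y \<tau>)\<bar>) -` {\<delta><..})"
    by (rule continuous_open_preimage[OF _ U]) simp
  also have "U \<inter> (\<lambda>\<tau>. Re (X \<tau>) - \<bar>Re (Y \<tau>)\<bar>) -` {\<delta><..} = V"
    by (auto simp: V_def)
  finally have "open V" .
  moreover have "\<tau>0 \<in> V" using \<tau>0 \<delta> by (simp add: V_def \<delta>_def)
  ultimately obtain d where d: "d > 0" "cball \<tau>0 d \<subseteq> V"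
    by (auto simp: open_contains_cball)
  have "uniform_limit (cball \<tau>0 d) (\<lambda>N \<tau>. \<Sum>n<N. ?f n \<tau>) (\<lambda>\<tau>. \<Sum>n. ?f n \<tau>) sequentially"
  proof (rule Weierstrass_m_test[OF _ summable_theta_bessel_bound[OF \<delta>]])
    fix n \<tau> assume "\<tau> \<in> cball \<tau>0 d"
    then have "\<tau> \<in> V" using d by auto
    then show "norm (?f n \<tau>) \<le> real (rep_squares k n) * exp (- (pi * \<delta> * real n)) * (poisson_const \<mu> * moment \<mu> 0)"
      by (intro norm_theta_bessel_term_le) (simp add: V_def)
  qed
  then show "\<exists>d. 0 < d \<and> cball \<tau>0 d \<subseteq> U \<and> uniform_limit (cball \<tau>0 d) (\<lambda>N \<tau>. \<Sum>n<N. ?f n \<tau>)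
      (\<lambda>\<tau>. theta_bessel k (X \<tau>) (Y \<tau>)) sequentially"
    using d by (intro exI[of _ d]) (auto simp: V_def theta_bessel_def)
qed

text \<open>
  Under Poisson's integral the series becomes a sum of exponentials in n (x - y u) for each u, which is the
  k-th power of the theta series.
\<close>

lemma theta_power_integral:
  fixes x y :: real
  assumes xy: "\<bar>y\<bar> < x"
  shows "integrable (gegenbauer_measure \<mu>) (\<lambda>u. theta_power k (pi * (x - y * u)))"
    and "theta_bessel k (of_real x) (of_real y)
      = of_real (poisson_const \<mu> * (\<integral>u. theta_power k (pi * (x - y * u)) \<partial>gegenbauer_measure \<mu>))"
proof -
  let ?M = "gegenbauer_measure \<mu>"
  let ?f = "\<lambda>n u. real (rep_squares k n) * exp (- (pi * (x - y * u) * real n))"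
  let ?B = "\<lambda>n. real (rep_squares k n) * exp (- (pi * (x - \<bar>y\<bar>) * real n))"
  have bound: "norm (?f n u) \<le> ?B n" if "\<bar>u\<bar> \<le> 1" for n u
  proof -
    have "\<bar>y * u\<bar> \<le> \<bar>y\<bar>" using that by (simp add: abs_mult mult_left_le)
    then have "y * u \<le> \<bar>y\<bar>" by linarith
    then show ?thesis by (auto intro!: mult_left_mono mult_right_mono)
  qed
  have int: "integrable ?M (?f n)" for n
    by (rule integrable_gegenbauer_bounded[OF \<mu>_pos _ bound]) measurable
  have B: "summable ?B" using xy by (intro summable_rep_squares) simp
  have AE: "AE u in ?M. summable (\<lambda>n. norm (?f n u))"
    using AE_gegenbauer_measure
  proof eventually_elim
    case (elim u)
    then have u: "\<bar>u\<bar> \<le> 1" by auto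
    show ?case by (rule summable_comparison_test'[OF B]) (use bound[OF u] in simp)
  qed
  have "summable (\<lambda>n. \<integral>u. norm (?f n u) \<partial>?M)"
  proof (rule summable_comparison_test'[OF summable_mult2[OF B]])
    fix n
    have "(\<integral>u. norm (?f n u) \<partial>?M) \<le> (\<integral>u. ?B n * u ^ 0 \<partial>?M)"
    proof (rule integral_mono_AE)
      show "integrable ?M (\<lambda>u. ?B n * u ^ 0)"
        by (intro integrable_mult_right integrable_power \<mu>_pos)
      show "AE u in ?M. norm (?f n u) \<le> ?B n * u ^ 0"
        using AE_gegenbauer_measure by eventually_elim (use bound in \<open>auto simp: abs_le_iff\<close>)
    qed (use int in auto)
    also have "\<dots> = ?B n * moment \<mu> 0" by (simp add: moment_def)
    finally show "norm (\<integral>u. norm (?f n u) \<partial>?M) \<le> ?B n * moment \<mu> 0"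
      by (simp add: integral_nonneg_AE)
  qed
  note * = int AE this
  show "integrable ?M (\<lambda>u. theta_power k (pi * (x - y * u)))"
    unfolding theta_power_def by (rule integrable_suminf[OF *])
  have "(\<lambda>n. integral\<^sup>L ?M (?f n)) sums (\<integral>u. theta_power k (pi * (x - y * u)) \<partial>?M)"
    unfolding theta_power_def by (rule sums_integral[OF *])
  then have "(\<lambda>n. complex_of_real (poisson_const \<mu> * integral\<^sup>L ?M (?f n)))
      sums of_real (poisson_const \<mu> * (\<integral>u. theta_power k (pi * (x - y * u)) \<partial>?M))"
    by (intro sums_of_real sums_mult)
  moreover have "complex_of_real (poisson_const \<mu> * integral\<^sup>L ?M (?f n)) = theta_bessel_term k (of_real x) (of_real y) n" for n
  proof -
    have "?f n = (\<lambda>u. real (rep_squares k n) * exp (- (pi * real n * x)) * exp (pi * real n * y * u))"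
      by (simp add: fun_eq_iff algebra_simps flip: exp_add)
    then have "integral\<^sup>L ?M (?f n) = real (rep_squares k n) * exp (- (pi * real n * x)) * (\<integral>u. exp (pi * real n * y * u) \<partial>?M)"
      by (simp only: integral_mult_right_zero)
    moreover have "of_real pi * of_nat n * of_real y = complex_of_real (pi * real n * y)"
      "exp (- (of_real pi * of_nat n * of_real x)) = complex_of_real (exp (- (pi * real n * x)))"
      by (simp_all flip: exp_of_real)
    ultimately show ?thesis
      unfolding theta_bessel_term_def order_eq
      by (simp only: bessel_I_series_of_real[OF \<mu>_pos]) simp
  qed
  ultimately show "theta_bessel k (of_real x) (of_real y)
      = of_real (poisson_const \<mu> * (\<integral>u. theta_power k (pi * (x - y * u)) \<partial>?M))"
    unfolding theta_bessel_def by (simp add: sums_iff)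
qed

text \<open>
  With t = x - y u, the substitution v = (x u - y)/t gives 1 - v^2 = w (1 - u^2)/t^2, dv = w/t^2 du and
  (x + y v)/w = 1/t.  So the weighted measure is multiplied by w^\<mu> t^(- 2 \<mu>), and the inversion of the
  theta series at t contributes t^(k/2), which is t^(2 \<mu>).
\<close>

lemma theta_power_integral_moebius:
  fixes x y :: real
  assumes xy: "\<bar>y\<bar> < x"
  defines "w \<equiv> x ^ 2 - y ^ 2"
  shows "(\<integral>v. theta_power k (pi * (x / w + y / w * v)) \<partial>gegenbauer_measure \<mu>)
    = w powr \<mu> * (\<integral>u. theta_power k (pi * (x - y * u)) \<partial>gegenbauer_measure \<mu>)"
proof -
  let ?P = "\<lambda>u. (1 - u ^ 2) powr (\<mu> - 1)"
  let ?T = "\<lambda>v. theta_power k (pi * (x / w + y / w * v))"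
  have "w = (x + y) * (x - y)" by (simp add: w_def power2_eq_square algebra_simps)
  then have w: "w > 0" using xy by auto
  have s: "x - y * u > 0" if "u \<in> {-1..1}" for u
  proof -
    have "\<bar>u\<bar> \<le> 1" using that by auto
    then have "\<bar>y * u\<bar> \<le> \<bar>y\<bar>" by (simp add: abs_mult mult_left_le)
    then show ?thesis using xy by linarith
  qed
  define g where "g u = (x * u - y) / (x - y * u)" for u
  define g' where "g' u = w / (x - y * u) ^ 2" for u
  have g1: "g 1 = 1" "g (- 1) = - 1" using s[of 1] s[of "-1"] by (auto simp: g_def field_simps)
  have dom: "\<bar>- (y / w)\<bar> < x / w"
    using xy w by (simp add: divide_strict_right_mono)
  have int: "set_integrable lborel {g (- 1)..g 1} (\<lambda>v. ?P v * ?T v)"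
    using theta_power_integral(1)[OF dom]
    by (subst (asm) integrable_gegenbauer_measure) (simp_all add: set_integrable_def gegenbauer_weight_def g1 mult.assoc)
  have der: "(g has_real_derivative g' u) (at u)" if "u \<in> {-1..1}" for u
  proof -
    have "(g has_real_derivative (x * (x - y * u) - (x * u - y) * (- y)) / ((x - y * u) * (x - y * u))) (at u)"
      unfolding g_def[abs_def] using s[OF that] by (auto intro!: derivative_eq_intros)
    then show ?thesis
      by (simp add: g'_def w_def power2_eq_square algebra_simps)
  qed
  have "(\<integral>v. ?T v \<partial>gegenbauer_measure \<mu>) = (LBINT v. (?P v * ?T v) * indicator {g (- 1)..g 1} v)"
    by (subst integral_gegenbauer_measure) (simp_all add: gegenbauer_weight_def g1 mult_ac)
  also have "\<dots> = (LBINT u. (?P (g u) * ?T (g u)) * g' u * indicator {-1..1} u)"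
  proof (rule integral_substitution(2)[OF int der])
    show "continuous_on {- 1..1} g'"
      unfolding g'_def[abs_def] using s by (intro continuous_intros) (auto simp: less_le)
  qed (use w in \<open>auto simp: g'_def\<close>)
  also have "\<dots> = (LBINT u. w powr \<mu> * (gegenbauer_weight \<mu> u *\<^sub>R theta_power k (pi * (x - y * u))))"
  proof (rule Bochner_Integration.integral_cong[OF refl])
    fix u :: real
    show "(?P (g u) * ?T (g u)) * g' u * indicator {-1..1} u
      = w powr \<mu> * (gegenbauer_weight \<mu> u *\<^sub>R theta_power k (pi * (x - y * u)))"
    proof (cases "u \<in> {-1..1}")
      case True
      define t where "t = x - y * u"
      have t: "t > 0" using s[OF True] by (simp add: t_def)
      have gu: "g u = (x * u - y) / t" by (simp add: g_def t_def)
      have "1 - g u ^ 2 = (t ^ 2 - (x * u - y) ^ 2) / t ^ 2"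
        unfolding gu power_divide using t by (simp add: diff_divide_distrib)
      also have "t ^ 2 - (x * u - y) ^ 2 = w * (1 - u ^ 2)"
        by (simp add: t_def w_def power2_eq_square algebra_simps)
      finally have g2: "1 - g u ^ 2 = w * (1 - u ^ 2) / t ^ 2" .
      have u2: "1 - u ^ 2 \<ge> 0" using True by (simp add: abs_square_le_1 abs_le_iff)
      have "?P (g u) = w powr (\<mu> - 1) * ?P u / (t ^ 2) powr (\<mu> - 1)"
        unfolding g2 using u2 w t by (simp add: powr_divide powr_mult)
      then have P: "?P (g u) * g' u = w powr \<mu> * ?P u / t powr (2 * \<mu>)"
      proof -
        have "w powr \<mu> = w powr (\<mu> - 1) * w" "(t ^ 2) powr \<mu> = (t ^ 2) powr (\<mu> - 1) * t ^ 2"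
          using w t by (simp_all add: powr_diff)
        moreover have "(t ^ 2) powr \<mu> = t powr (2 * \<mu>)"
          using t by (simp add: powr_powr flip: powr_numeral)
        ultimately show ?thesis
          using \<open>?P (g u) = _\<close> by (simp add: g'_def t_def[symmetric])
      qed
      have "x / w + y / w * g u = 1 / t"
      proof -
        have "x / w + y / w * g u = (x * t + y * (x * u - y)) / (w * t)"
          unfolding gu using w t by (simp add: field_simps)
        also have "x * t + y * (x * u - y) = w"
          by (simp add: t_def w_def power2_eq_square algebra_simps)
        finally show ?thesis using w by simp
      qed
      then have "?T (g u) = theta_power k (pi / t)" by simp
      also have "\<dots> = t powr (2 * \<mu>) * theta_power k (pi * t)"
        using theta_power_inversion[OF t, of k] by (simp add: \<mu>_def)
      finally have T: "?T (g u) = t powr (2 * \<mu>) * theta_power k (pi * t)" .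
      have "?P (g u) * ?T (g u) * g' u = (?P (g u) * g' u) * ?T (g u)" by simp
      also have "\<dots> = w powr \<mu> * ?P u * theta_power k (pi * t)"
        unfolding P T using t by simp
      finally show ?thesis using True by (simp add: gegenbauer_weight_def t_def)
    qed (simp add: gegenbauer_weight_def)
  qed
  also have "\<dots> = w powr \<mu> * (\<integral>u. theta_power k (pi * (x - y * u)) \<partial>gegenbauer_measure \<mu>)"
    by (subst integral_gegenbauer_measure) (simp_all only: integral_mult_right_zero, measurable)
  finally show ?thesis .
qed

text \<open>
  Poisson's integral expresses the series at (x/w, y/w) through x/w - (y/w) v, while the Moebius map
  produces x/w + (y/w) v; the series is even in its second argument.
\<close>

lemma theta_bessel_transformation_real:
  fixes x y :: real
  assumes xy: "\<bar>y\<bar> < x"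
  defines "w \<equiv> x ^ 2 - y ^ 2"
  shows "theta_bessel k (of_real x) (of_real y)
    = of_real w powr (- of_real \<mu>) * theta_bessel k (of_real (x / w)) (of_real (y / w))"
proof -
  have "w = (x + y) * (x - y)" by (simp add: w_def power2_eq_square algebra_simps)
  then have w: "w > 0" using xy by auto
  have dom: "\<bar>- (y / w)\<bar> < x / w"
    using xy w by (simp add: divide_strict_right_mono)
  have "theta_bessel k (of_real (x / w)) (of_real (y / w)) = theta_bessel k (of_real (x / w)) (of_real (- (y / w)))"
    using theta_bessel_minus[of k "of_real (x / w)" "of_real (y / w)"] by (simp only: of_real_minus)
  also have "\<dots> = of_real (poisson_const \<mu> * (\<integral>v. theta_power k (pi * (x / w + y / w * v)) \<partial>gegenbauer_measure \<mu>))"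
    using theta_power_integral(2)[OF dom] by simp
  also have "(\<integral>v. theta_power k (pi * (x / w + y / w * v)) \<partial>gegenbauer_measure \<mu>)
    = w powr \<mu> * (\<integral>u. theta_power k (pi * (x - y * u)) \<partial>gegenbauer_measure \<mu>)"
    unfolding w_def by (rule theta_power_integral_moebius[OF xy])
  also have "complex_of_real (poisson_const \<mu> * (w powr \<mu> * (\<integral>u. theta_power k (pi * (x - y * u)) \<partial>gegenbauer_measure \<mu>)))
     = of_real (w powr \<mu>) * theta_bessel k (of_real x) (of_real y)"
    unfolding theta_power_integral(2)[OF xy] by simp
  finally have "theta_bessel k (of_real (x / w)) (of_real (y / w)) = of_real (w powr \<mu>) * theta_bessel k (of_real x) (of_real y)" .
  moreover have "of_real w powr (- of_real \<mu>) * complex_of_real (w powr \<mu>) = 1"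
  proof -
    have "of_real w powr (- of_real \<mu>) = complex_of_real (w powr (- \<mu>))"
      using w powr_of_real[of w "- \<mu>"] by simp
    then show ?thesis using w by (simp flip: of_real_mult powr_add)
  qed
  ultimately show ?thesis by (simp flip: mult.assoc)
qed

text \<open>
  The line X(\<tau>) = Re x + \<tau> Im x, Y(\<tau>) = Re y + \<tau> Im y reaches (x, y) at \<tau> = i and has real
  coordinates for real \<tau>.  Its part in the domain |Re Y| < Re X is an open convex set that contains
  0 and i, so the identity theorem in one variable carries the real case to (x, y).
\<close>

theorem theta_bessel_transformation:
  assumes xy: "\<bar>Re y\<bar> < Re x"
  defines "w \<equiv> x ^ 2 - y ^ 2"
  shows "theta_bessel k x y = w powr (- of_real \<mu>) * theta_bessel k (x / w) (y / w)"
proof -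
  define X where "X \<tau> = of_real (Re x) + \<tau> * of_real (Im x)" for \<tau> :: complex
  define Y where "Y \<tau> = of_real (Re y) + \<tau> * of_real (Im y)" for \<tau> :: complex
  define W where "W \<tau> = X \<tau> ^ 2 - Y \<tau> ^ 2" for \<tau>
  define U where "U = {\<tau>. \<bar>Re (Y \<tau>)\<bar> < Re (X \<tau>)}"
  define H where "H \<tau> = theta_bessel k (X \<tau>) (Y \<tau>)
     - W \<tau> powr (- of_real \<mu>) * theta_bessel k (X \<tau> / W \<tau>) (Y \<tau> / W \<tau>)" for \<tau>
  have cont: "continuous_on UNIV (\<lambda>\<tau>. Re (X \<tau>))" "continuous_on UNIV (\<lambda>\<tau>. \<bar>Re (Y \<tau>)\<bar>)"
    unfolding X_def Y_def by (intro continuous_intros)+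
  have "open U" unfolding U_def by (intro open_Collect_less cont)
  have strip: "\<bar>b + t * d\<bar> < a + t * c \<longleftrightarrow> - (a + b) < (c + d) * t \<and> - (a - b) < (c - d) * t" for a b c d t :: real
  proof -
    have "(c + d) * t = t * c + t * d" "(c - d) * t = t * c - t * d"
      by (simp_all add: distrib_left right_diff_distrib mult.commute[of _ t])
    moreover have "\<bar>b + q\<bar> < a + p \<longleftrightarrow> - (a + b) < p + q \<and> - (a - b) < p - q" for p q :: real
      by linarith
    ultimately show ?thesis by (simp only:)
  qed
  have "U = {\<tau>. - (Re x + Re y) < of_real (Im x + Im y) \<bullet> \<tau>} \<inter> {\<tau>. - (Re x - Re y) < of_real (Im x - Im y) \<bullet> \<tau>}"
  proof (rule set_eqI)
    fix \<tau>
    have "Re (X \<tau>) = Re x + Re \<tau> * Im x" "Re (Y \<tau>) = Re y + Re \<tau> * Im y"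
      by (simp_all add: X_def Y_def)
    moreover have "of_real c \<bullet> \<tau> = c * Re \<tau>" for c
      by (simp add: inner_complex_def)
    ultimately show "\<tau> \<in> U \<longleftrightarrow> \<tau> \<in> {\<tau>. - (Re x + Re y) < of_real (Im x + Im y) \<bullet> \<tau>} \<inter> {\<tau>. - (Re x - Re y) < of_real (Im x - Im y) \<bullet> \<tau>}"
      by (simp only: U_def Int_iff mem_Collect_eq strip)
  qed
  then have "convex U" by (simp only: convex_Int convex_halfspace_gt)
  then have "connected U" by (rule convex_connected)
  have holXY: "X holomorphic_on U" "Y holomorphic_on U" "W holomorphic_on U"
    unfolding X_def[abs_def] Y_def[abs_def] W_def[abs_def] by (auto intro!: holomorphic_intros)
  have dom: "W \<tau> \<notin> \<real>\<^sub>\<le>\<^sub>0" "W \<tau> \<noteq> 0" "\<bar>Re (Y \<tau> / W \<tau>)\<bar> < Re (X \<tau> / W \<tau>)" if "\<tau> \<in> U" for \<tau>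
    using Re_quotient_domain[of "Y \<tau>" "X \<tau>"] that by (simp_all add: U_def W_def)
  have "H holomorphic_on U"
    unfolding H_def[abs_def] using dom holXY \<open>open U\<close>
    by (intro holomorphic_intros theta_bessel_holomorphic) (auto simp: U_def)
  have "0 \<in> U" "\<i> \<in> U" using xy by (simp_all add: U_def X_def Y_def)
  have islim: "0 islimpt (U \<inter> \<real>)"
  proof -
    have "(0::complex) islimpt \<real>"
      unfolding islimpt_sequential
    proof (intro exI[of _ "\<lambda>n. of_real (1 / real (Suc n))"] conjI allI)
      show "complex_of_real (1 / real (Suc n)) \<in> \<real> - {0}" for n
        by (simp del: of_nat_Suc of_real_divide)
      have "(\<lambda>n. complex_of_real (1 / real (Suc n))) \<longlonglongrightarrow> of_real 0"
        by (intro tendsto_of_real LIMSEQ_Suc lim_1_over_n)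
      then show "(\<lambda>n. complex_of_real (1 / real (Suc n))) \<longlonglongrightarrow> 0" by simp
    qed
    then have "0 islimpt (\<real> \<inter> U)"
      using \<open>0 \<in> U\<close> \<open>open U\<close> by (intro islimpt_Int_eventually eventually_at_in_open')
    then show ?thesis by (simp only: Int_commute)
  qed
  have "H \<i> = 0"
  proof (rule analytic_continuation[OF \<open>H holomorphic_on U\<close> \<open>open U\<close> \<open>connected U\<close> _ \<open>0 \<in> U\<close> islim _ \<open>\<i> \<in> U\<close>])
    fix \<tau> assume "\<tau> \<in> U \<inter> \<real>"
    then obtain t where t: "\<tau> = of_real t" "\<tau> \<in> U" by (auto elim!: Reals_cases)
    define x' where "x' = Re x + t * Im x"
    define y' where "y' = Re y + t * Im y"
    have XY: "X \<tau> = of_real x'" "Y \<tau> = of_real y'"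
      by (simp_all add: X_def Y_def t x'_def y'_def)
    have "\<bar>y'\<bar> < x'" using t XY by (simp add: U_def)
    from theta_bessel_transformation_real[OF this] show "H \<tau> = 0"
      by (simp add: H_def W_def XY)
  qed auto
  moreover have "X \<i> = x" "Y \<i> = y" by (simp_all add: X_def Y_def complex_eq_iff)
  ultimately show ?thesis by (simp add: H_def W_def w_def)
qed

end

section \<open>Powers and branches\<close>

lemma ppow_nonzero: "z \<noteq> 0 \<Longrightarrow> ppow z a = z powr a"
  by (simp add: ppow_def)

lemma ppow_of_real_mult:
  assumes "c > 0"
  shows "ppow (of_real c * y) \<nu> = of_real c powr \<nu> * ppow y \<nu>"
proof (cases "\<nu> = 0 \<or> y = 0")
  case False
  then show ?thesis
    using assms by (simp add: ppow_def powr_def Ln_times_of_real Ln_of_real distrib_left exp_add)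
qed (use assms in \<open>auto simp: ppow_def\<close>)

lemma theta_bessel_term_0: "theta_bessel_term k x y 0 = 1 / Gamma (of_nat k / 4 + 1 / 2)" if "k \<ge> 1"
proof -
  have "bessel_I_series (of_real (real k / 4) - 1 / 2) 0 = 1 / of_real (Gamma (real k / 4 + 1 / 2))"
    by (rule bessel_I_series_0) (use that in simp)
  also have "complex_of_real (Gamma (real k / 4 + 1 / 2)) = Gamma (of_nat k / 4 + 1 / 2)"
    by (subst Gamma_complex_of_real[symmetric]) simp
  finally show ?thesis by (simp add: theta_bessel_term_def rep_squares_0)
qed

text \<open>
  The common shape of the two parts: Q stands for (\<pi> y/2)^\<nu>, and z is y for I and i y for J.  The term
  n = 0 is split off on both sides, and w^(-1/2) w^(- \<nu>) = w^(- k/4).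
\<close>

lemma transformation_of_sums:
  fixes k :: nat and \<nu> x z Q :: complex
  assumes k: "k \<ge> 1" and \<nu>: "\<nu> = of_nat k / 4 - 1 / 2" and xz: "\<bar>Re z\<bar> < Re x" and w: "w = x ^ 2 - z ^ 2"
    and A: "\<And>n. A (Suc n) = Q * theta_bessel_term k x z (Suc n)"
    and B: "\<And>n. B (Suc n) = Q * w powr (- \<nu>) * theta_bessel_term k (x / w) (z / w) (Suc n)"
  shows "summable (\<lambda>n. A (Suc n)) \<and> summable (\<lambda>n. B (Suc n)) \<and>
    Q / Gamma (of_nat k / 4 + 1 / 2) + (\<Sum>n. A (Suc n))
      = Q / (Gamma (of_nat k / 4 + 1 / 2) * w powr (of_nat k / 4)) + 1 / csqrt w * (\<Sum>n. B (Suc n))"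
proof -
  let ?\<Gamma> = "Gamma (of_nat k / 4 + 1 / 2) :: complex"
  let ?a = "theta_bessel_term k x z" and ?b = "theta_bessel_term k (x / w) (z / w)"
  have dom: "\<bar>Re (z / w)\<bar> < Re (x / w)"
    using Re_quotient_domain(3)[OF xz] by (simp add: w)
  have a: "summable ?a" and b: "summable ?b"
    using summable_theta_bessel[OF k refl] xz dom by blast+
  have a1: "summable (\<lambda>n. ?a (Suc n))" and b1: "summable (\<lambda>n. ?b (Suc n))"
    using a b by (simp_all only: summable_Suc_iff)
  have Sa: "theta_bessel k x z = 1 / ?\<Gamma> + (\<Sum>n. ?a (Suc n))"
    unfolding theta_bessel_def using suminf_split_head[OF a] theta_bessel_term_0[OF k] by simp
  have Sb: "theta_bessel k (x / w) (z / w) = 1 / ?\<Gamma> + (\<Sum>n. ?b (Suc n))"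
    unfolding theta_bessel_def using suminf_split_head[OF b] theta_bessel_term_0[OF k] by simp
  have "theta_bessel k x z = w powr (- of_real (real k / 4)) * theta_bessel k (x / w) (z / w)"
    unfolding w by (rule theta_bessel_transformation[OF k refl xz])
  then have eq: "1 / ?\<Gamma> + (\<Sum>n. ?a (Suc n)) = w powr (- (of_nat k / 4)) * (1 / ?\<Gamma> + (\<Sum>n. ?b (Suc n)))"
    unfolding Sa Sb by simp
  have pw: "1 / csqrt w * w powr (- \<nu>) = w powr (- (of_nat k / 4))"
  proof -
    have "1 / csqrt w = w powr (- (1 / 2))"
      unfolding csqrt_conv_powr powr_minus by (simp only: divide_inverse mult_1)
    moreover have "w powr (- (1 / 2)) * w powr (- \<nu>) = w powr (- (1 / 2) + - \<nu>)"
      by (rule powr_add[symmetric])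
    moreover have "- (1 / 2) + - \<nu> = - (of_nat k / 4)" by (simp add: \<nu>)
    ultimately show ?thesis by simp
  qed
  have distr: "Q * (p * (1 / c + S)) = Q / c * p + p * (Q * S)" for p c S :: complex
    by (simp add: algebra_simps)
  have "Q / ?\<Gamma> + (\<Sum>n. A (Suc n)) = Q / ?\<Gamma> + Q * (\<Sum>n. ?a (Suc n))"
    unfolding A suminf_mult[OF a1] ..
  also have "\<dots> = Q * (1 / ?\<Gamma> + (\<Sum>n. ?a (Suc n)))"
    by (simp only: distrib_left times_divide_eq_right mult_1_right)
  also have "\<dots> = Q / ?\<Gamma> * w powr (- (of_nat k / 4)) + w powr (- (of_nat k / 4)) * (Q * (\<Sum>n. ?b (Suc n)))"
    unfolding eq by (rule distr)
  also have "Q / ?\<Gamma> * w powr (- (of_nat k / 4)) = Q / (?\<Gamma> * w powr (of_nat k / 4))"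
    by (simp only: powr_minus divide_inverse inverse_mult_distrib mult.assoc)
  also have "w powr (- (of_nat k / 4)) * (Q * (\<Sum>n. ?b (Suc n))) = 1 / csqrt w * (\<Sum>n. B (Suc n))"
    unfolding B suminf_mult[OF b1] pw[symmetric] by (simp only: mult_ac)
  finally show ?thesis
    unfolding A B using a1 b1 by (intro conjI summable_mult) simp_all
qed

theorem corollary2p1:
  fixes k :: nat and \<nu> :: complex
  assumes "k \<ge> 1" and "\<nu> = of_nat k / 4 - 1 / 2"
  shows "(\<forall>x y :: complex. Re x > \<bar>Im y\<bar> \<and> (k = 1 \<longrightarrow> y \<noteq> 0) \<longrightarrow>
      (let A = (\<lambda>n. of_nat (rep_squares k n) / of_nat n powr \<nu> * exp (- of_real pi * of_nat n * x)
            * bessel_J \<nu> (of_real pi * of_nat n * y));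
           B = (\<lambda>n. of_nat (rep_squares k n) / of_nat n powr \<nu> * exp (- of_real pi * of_nat n * x / (x^2 + y^2))
            * bessel_J_quot \<nu> (pi * real n) y (x^2 + y^2))
       in summable (\<lambda>n. A (Suc n)) \<and> summable (\<lambda>n. B (Suc n)) \<and>
          ppow (of_real pi * y) \<nu> / (2 powr \<nu> * Gamma (of_nat k / 4 + 1 / 2)) + (\<Sum>n. A (Suc n))
          = ppow (of_real pi * y) \<nu> / (2 powr \<nu> * Gamma (of_nat k / 4 + 1 / 2) * (x^2 + y^2) powr (of_nat k / 4))
            + 1 / csqrt (x^2 + y^2) * (\<Sum>n. B (Suc n))))
    \<and>
    (\<forall>x y :: complex. Re x > \<bar>Re y\<bar> \<and> (k = 1 \<longrightarrow> y \<noteq> 0) \<longrightarrow>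
      (let A = (\<lambda>n. of_nat (rep_squares k n) / of_nat n powr \<nu> * exp (- of_real pi * of_nat n * x)
            * bessel_I \<nu> (of_real pi * of_nat n * y));
           B = (\<lambda>n. of_nat (rep_squares k n) / of_nat n powr \<nu> * exp (- of_real pi * of_nat n * x / (x^2 - y^2))
            * bessel_I_quot \<nu> (pi * real n) y (x^2 - y^2))
       in summable (\<lambda>n. A (Suc n)) \<and> summable (\<lambda>n. B (Suc n)) \<and>
          ppow (of_real pi * y) \<nu> / (2 powr \<nu> * Gamma (of_nat k / 4 + 1 / 2)) + (\<Sum>n. A (Suc n))
          = ppow (of_real pi * y) \<nu> / (2 powr \<nu> * Gamma (of_nat k / 4 + 1 / 2) * (x^2 - y^2) powr (of_nat k / 4))
            + 1 / csqrt (x^2 - y^2) * (\<Sum>n. B (Suc n))))"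
proof -
  have prefactor: "ppow (of_real pi * y) \<nu> / (2 powr \<nu> * G) = ppow (of_real (pi / 2) * y) \<nu> / G" for y G
    proof -
    have "ppow (of_real pi * y) \<nu> = ppow (of_real 2 * (of_real (pi / 2) * y)) \<nu>" by simp
    also have "\<dots> = 2 powr \<nu> * ppow (of_real (pi / 2) * y) \<nu>"
      by (subst ppow_of_real_mult) simp_all
    finally show ?thesis by (simp add: powr_def)
  qed
  have ppow_n: "ppow (of_real pi * of_nat (Suc n) * y / 2) \<nu> = of_nat (Suc n) powr \<nu> * ppow (of_real (pi / 2) * y) \<nu>" for n y
  proof -
    have "of_real pi * of_nat (Suc n) * y / 2 = of_real (real (Suc n)) * (of_real (pi / 2) * y)"
      by (simp add: algebra_simps)
    then show ?thesis
      using ppow_of_real_mult[of "real (Suc n)" "of_real (pi / 2) * y" \<nu>] by (simp only: of_real_of_nat_eq)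
  qed
  have ppow_quot: "ppow (of_real (pi * real (Suc n) / 2)) \<nu> * ppow y \<nu> = of_nat (Suc n) powr \<nu> * ppow (of_real (pi / 2) * y) \<nu>" for n y
  proof -
    let ?c = "pi * real (Suc n) / 2"
    have c: "?c > 0" by simp
    have "(of_real ?c :: complex) \<noteq> 0" using c by (simp only: of_real_eq_0_iff)
    then have "ppow (of_real ?c) \<nu> = of_real ?c powr \<nu>"
      by (rule ppow_nonzero)
    then have "ppow (of_real ?c) \<nu> * ppow y \<nu> = ppow (of_real ?c * y) \<nu>"
      by (simp only: ppow_of_real_mult[OF c])
    also have "of_real ?c * y = of_real pi * of_nat (Suc n) * y / 2"
      by (simp del: of_nat_Suc)
    finally show ?thesis by (simp only: ppow_n)
  qed
  have cancel: "a / p * e * (p * Q * g) = Q * (a * e * g)" "a / p * e * (p * Q * v * g) = Q * v * (a * e * g)"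
    if "p = of_nat (Suc n) powr \<nu>" for n and a p e g Q v :: complex
    using that by (simp_all add: powr_def del: of_nat_Suc)
  note order = assms(2)[symmetric]
  show ?thesis
  proof (intro conjI allI impI; elim conjE)
    fix x y :: complex assume xy: "\<bar>Re y\<bar> < Re x"
    define w where "w = x ^ 2 - y ^ 2"
    have w0: "w \<noteq> 0" using Re_quotient_domain(2)[OF xy] by (simp add: w_def)
    show "let A = (\<lambda>n. of_nat (rep_squares k n) / of_nat n powr \<nu> * exp (- of_real pi * of_nat n * x)
            * bessel_I \<nu> (of_real pi * of_nat n * y));
           B = (\<lambda>n. of_nat (rep_squares k n) / of_nat n powr \<nu> * exp (- of_real pi * of_nat n * x / (x^2 - y^2))
            * bessel_I_quot \<nu> (pi * real n) y (x^2 - y^2))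
       in summable (\<lambda>n. A (Suc n)) \<and> summable (\<lambda>n. B (Suc n)) \<and>
          ppow (of_real pi * y) \<nu> / (2 powr \<nu> * Gamma (of_nat k / 4 + 1 / 2)) + (\<Sum>n. A (Suc n))
          = ppow (of_real pi * y) \<nu> / (2 powr \<nu> * Gamma (of_nat k / 4 + 1 / 2) * (x^2 - y^2) powr (of_nat k / 4))
            + 1 / csqrt (x^2 - y^2) * (\<Sum>n. B (Suc n))"
      unfolding Let_def w_def[symmetric] mult.assoc[of "2 powr \<nu>"] prefactor
    proof (rule transformation_of_sums[OF assms xy w_def])
      fix n
      have e: "- of_real pi * of_nat (Suc n) * x = - (of_real pi * of_nat (Suc n) * x)"
        "- (of_real pi * of_nat (Suc n) * x) / w = - (of_real pi * of_nat (Suc n) * (x / w))"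
        by simp_all
      have g: "of_real (pi * real (Suc n)) * y / w = of_real pi * of_nat (Suc n) * (y / w)"
        by simp
      show "of_nat (rep_squares k (Suc n)) / of_nat (Suc n) powr \<nu> * exp (- of_real pi * of_nat (Suc n) * x)
            * bessel_I \<nu> (of_real pi * of_nat (Suc n) * y)
          = ppow (of_real (pi / 2) * y) \<nu> * theta_bessel_term k x y (Suc n)"
        unfolding theta_bessel_term_def order bessel_I_def ppow_n e g by (rule cancel(1)[OF refl])
      show "of_nat (rep_squares k (Suc n)) / of_nat (Suc n) powr \<nu> * exp (- of_real pi * of_nat (Suc n) * x / w)
            * bessel_I_quot \<nu> (pi * real (Suc n)) y w
          = ppow (of_real (pi / 2) * y) \<nu> * w powr (- \<nu>) * theta_bessel_term k (x / w) (y / w) (Suc n)"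
        unfolding theta_bessel_term_def order bessel_I_quot_def ppow_quot ppow_nonzero[OF w0] e g by (rule cancel(2)[OF refl])
    qed
  next
    fix x y :: complex assume xy: "\<bar>Im y\<bar> < Re x"
    define w where "w = x ^ 2 + y ^ 2"
    have xz: "\<bar>Re (\<i> * y)\<bar> < Re x" using xy by simp
    have wz: "w = x ^ 2 - (\<i> * y) ^ 2" by (simp add: w_def power_mult_distrib)
    have w0: "w \<noteq> 0" using Re_quotient_domain(2)[OF xz] by (simp add: wz)
    show "let A = (\<lambda>n. of_nat (rep_squares k n) / of_nat n powr \<nu> * exp (- of_real pi * of_nat n * x)
            * bessel_J \<nu> (of_real pi * of_nat n * y));
           B = (\<lambda>n. of_nat (rep_squares k n) / of_nat n powr \<nu> * exp (- of_real pi * of_nat n * x / (x^2 + y^2))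
            * bessel_J_quot \<nu> (pi * real n) y (x^2 + y^2))
       in summable (\<lambda>n. A (Suc n)) \<and> summable (\<lambda>n. B (Suc n)) \<and>
          ppow (of_real pi * y) \<nu> / (2 powr \<nu> * Gamma (of_nat k / 4 + 1 / 2)) + (\<Sum>n. A (Suc n))
          = ppow (of_real pi * y) \<nu> / (2 powr \<nu> * Gamma (of_nat k / 4 + 1 / 2) * (x^2 + y^2) powr (of_nat k / 4))
            + 1 / csqrt (x^2 + y^2) * (\<Sum>n. B (Suc n))"
      unfolding Let_def w_def[symmetric] mult.assoc[of "2 powr \<nu>"] prefactor
    proof (rule transformation_of_sums[OF assms xz wz])
      fix n
      have e: "- of_real pi * of_nat (Suc n) * x = - (of_real pi * of_nat (Suc n) * x)"
        "- (of_real pi * of_nat (Suc n) * x) / w = - (of_real pi * of_nat (Suc n) * (x / w))"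
        by simp_all
      have g: "\<i> * (of_real pi * of_nat (Suc n) * y) = of_real pi * of_nat (Suc n) * (\<i> * y)"
        "\<i> * (of_real (pi * real (Suc n)) * y / w) = of_real pi * of_nat (Suc n) * ((\<i> * y) / w)"
        by simp_all
      show "of_nat (rep_squares k (Suc n)) / of_nat (Suc n) powr \<nu> * exp (- of_real pi * of_nat (Suc n) * x)
            * bessel_J \<nu> (of_real pi * of_nat (Suc n) * y)
          = ppow (of_real (pi / 2) * y) \<nu> * theta_bessel_term k x (\<i> * y) (Suc n)"
        unfolding theta_bessel_term_def order bessel_J_def bessel_J_series_eq_I ppow_n e g by (rule cancel(1)[OF refl])
      show "of_nat (rep_squares k (Suc n)) / of_nat (Suc n) powr \<nu> * exp (- of_real pi * of_nat (Suc n) * x / w)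
            * bessel_J_quot \<nu> (pi * real (Suc n)) y w
          = ppow (of_real (pi / 2) * y) \<nu> * w powr (- \<nu>) * theta_bessel_term k (x / w) ((\<i> * y) / w) (Suc n)"
        unfolding theta_bessel_term_def order bessel_J_quot_def bessel_J_series_eq_I ppow_quot ppow_nonzero[OF w0] e g by (rule cancel(2)[OF refl])
    qed
  qed
qed

end
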